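(* Let $n\ge 1$, let $\alpha\in(-\frac1n,0]$, and let $f,g\in C_\alpha(\mathbb{R}^n)$. Then $$\|f\star_\alpha g\|_1\le\min\left\{\frac{n+1}{2^n}\binom{2n}{n},\ \frac{2^n}{\prod_{j=1}^n(1+j\alpha)}\right\}\|f\star_\alpha\bar g\|_1 .$$
   Context: For $\alpha\in(-\infty,0]$, a function $f:\mathbb{R}^n\to[0,\infty)$ is $\alpha$-concave if for all $x,y$ with $f(x),f(y)>0$ and all $\lambda\in[0,1]$, $f(\lambda x+(1-\lambda)y)\ge[\lambda f(x)^\alpha+(1-\lambda)f(y)^\alpha]^{1/\alpha}$, where the right side is read as $f(x)^\lambda f(y)^{1-\lambda}$ for $\alpha=0$. $C_\alpha(\mathbb{R}^n)$ is the set of upper semicontinuous $\alpha$-concave $f:\mathbb{R}^n\to[0,\infty)$ with $\|f\|_\infty=f(0)=1$ and $\lim_{|x|\to\infty}f(x)=0$. The $\alpha$-sum is $(f\star_\alpha g)(x)=\sup_{y+z=x}(f(y)^\alpha+g(z)^\alpha-1)^{1/\alpha}$ for $-\infty<\alpha<0$ (the expression is $0$ whenever $f(y)=0$ or $g(z)=0$), and $(f\star_0 g)(x)=\sup_{y+z=x}f(y)g(z)$. $\bar g(x)=g(-x)$. $\|f\|_1=\int_{\mathbb{R}^n}f(x)\,dx$ for $f\ge0$. *)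

theory Defs
  imports "HOL-Analysis.Analysis"
begin

definition upper_semicontinuous :: "('a::topological_space \<Rightarrow> real) \<Rightarrow> bool" where
  "upper_semicontinuous f \<longleftrightarrow> (\<forall>x a. f x < a \<longrightarrow> (\<forall>\<^sub>F y in nhds x. f y < a))"

definition alpha_mean :: "real \<Rightarrow> real \<Rightarrow> real \<Rightarrow> real \<Rightarrow> real" where
  "alpha_mean \<alpha> t a b =
     (if \<alpha> = 0 then a powr t * b powr (1 - t)
      else (t * a powr \<alpha> + (1 - t) * b powr \<alpha>) powr (1 / \<alpha>))"

definition alpha_concave :: "real \<Rightarrow> ('a::real_vector \<Rightarrow> real) \<Rightarrow> bool" where
  "alpha_concave \<alpha> f \<longleftrightarrow>
     (\<forall>x y. f x > 0 \<longrightarrow> f y > 0 \<longrightarrow>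
        (\<forall>t\<in>{0..1}. f (t *\<^sub>R x + (1 - t) *\<^sub>R y) \<ge> alpha_mean \<alpha> t (f x) (f y)))"

text \<open>The sup norm is a pointwise (not essential) supremum. The supremum of an unbounded
  set of reals is unspecified in HOL, hence the explicit boundedness.\<close>

definition C_alpha :: "real \<Rightarrow> (real ^ 'n \<Rightarrow> real) set" where
  "C_alpha \<alpha> =
     {f. (\<forall>x. f x \<ge> 0) \<and> upper_semicontinuous f \<and> alpha_concave \<alpha> f \<and>
         bdd_above (range f) \<and> (SUP x. f x) = f 0 \<and> f 0 = 1 \<and>
         (f \<longlongrightarrow> 0) at_infinity}"

text \<open>For negative \<open>\<alpha>\<close> the value at a zero argument is the limit value \<open>0\<close>
  (where the power is read as \<open>\<infinity>\<close>); this needs a separate case, as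
  \<open>0 powr \<alpha> = 0\<close> in HOL.\<close>

definition alpha_sum_term :: "real \<Rightarrow> real \<Rightarrow> real \<Rightarrow> real" where
  "alpha_sum_term \<alpha> a b =
     (if \<alpha> = 0 then a * b
      else if a = 0 \<or> b = 0 then 0
      else (a powr \<alpha> + b powr \<alpha> - 1) powr (1 / \<alpha>))"

text \<open>For \<open>f\<close> and \<open>g\<close> with values in \<open>[0, 1]\<close>, in particular for members of
  \<open>C_alpha \<alpha>\<close> with \<open>\<alpha> \<le> 0\<close>, the supremum is over a nonempty set of reals in \<open>[0, 1]\<close>.\<close>

definition alpha_sum :: "real \<Rightarrow> ('a::ab_group_add \<Rightarrow> real) \<Rightarrow> ('a \<Rightarrow> real) \<Rightarrow> 'a \<Rightarrow> real" where
  "alpha_sum \<alpha> f g x = (SUP (y, z)\<in>{(y, z). y + z = x}. alpha_sum_term \<alpha> (f y) (g z))"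

definition reflection :: "('a::ab_group_add \<Rightarrow> real) \<Rightarrow> 'a \<Rightarrow> real" where
  "reflection g x = g (- x)"

text \<open>Only meant for nonnegative functions: \<open>ennreal\<close> cuts off negative values.\<close>

definition L1_norm :: "(real ^ 'n \<Rightarrow> real) \<Rightarrow> ennreal" where
  "L1_norm f = (\<integral>\<^sup>+ x. ennreal (f x) \<partial>lborel)"

end

theory Submission
  imports Defs
begin

text \<open>  Both terms of the minimum are at least \<open>2 ^ n\<close>, and the inequality is proved with the constant
  \<open>2 ^ n\<close>.

  Log-concave case. For functions \<open>A\<close>, \<open>B\<close> write \<open>(A \<star> B) x = sup\<^sub>y A y * B (x - y)\<close>, and call
  \<open>w \<star> reflect w\<close> the difference function of \<open>w\<close>. The functions \<open>w = A \<star> B\<close> and \<open>h = A \<star> reflect B\<close>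
  have the same difference function \<open>E\<close>, since a difference of sums \<open>(y + z) - (y' + z')\<close> is also a
  difference of differences \<open>(y - z') - (y' - z)\<close>. This \<open>E\<close> is compared with both: the
  Prekopa-Leindler inequality gives \<open>2 ^ n * \<integral> w\<^sup>2 \<le> \<integral> E\<close> (lemma
  \<open>nn_integral_difference_function_ge\<close>), and an argument of Rogers-Shephard type, in which a pair of points
  is averaged with a point of the diagonal, gives \<open>\<integral> E \<le> 4 ^ n * \<integral> h\<^sup>2\<close> for log-concave \<open>h\<close> (lemma
  \<open>nn_integral_difference_function_le\<close>). Together \<open>\<integral> w\<^sup>2 \<le> 2 ^ n * \<integral> h\<^sup>2\<close>. For \<open>A\<close> and \<open>B\<close> the
  square roots of \<open>f\<close> and \<open>g\<close> this is the case \<open>\<alpha> = 0\<close>. The Prekopa-Leindler inequality is proved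
  by induction on the dimension from the Brunn-Minkowski inequality on the line.

  Negative \<open>\<alpha>\<close>. The functions \<open>F = exp (1 - f powr \<alpha>)\<close> and \<open>G = exp (1 - g powr \<alpha>)\<close>, extended by \<open>0\<close>, are
  log-concave, and the \<open>\<alpha>\<close>-sum of \<open>f\<close> and \<open>g\<close> is \<open>(1 - ln W) powr (1 / \<alpha>)\<close> with \<open>W = F \<star> G\<close>. By Euler's integral
  for the Gamma function this is a mixture of the powers \<open>W powr t\<close> with positive weights that do
  not depend on \<open>f\<close> and \<open>g\<close>. As \<open>W powr t\<close> is the sup-convolution of the log-concave functions
  \<open>F powr t\<close> and \<open>G powr t\<close>, the log-concave case applies to every power, and integrating over \<open>t\<close>
  gives the result with the same constant.

  Measurability. Upper semicontinuous functions have closed superlevel sets, and suprema over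
  sums of points correspond to images of superlevel sets under addition. All functions involved are therefore
  kept in the class of functions whose strict superlevel sets are countable unions of closed sets,
  which such images preserve in Euclidean space.\<close>

section \<open>Sup-convolution and \<open>F\<^sub>\<sigma>\<close> superlevel sets\<close>

lemma fsigma_iff_fsigma_in: "fsigma S \<longleftrightarrow> fsigma_in euclidean S"
proof
  assume "fsigma S"
  then obtain F :: "nat \<Rightarrow> 'a set" where "\<And>n. closed (F n)" "S = \<Union>(range F)"
    by (auto elim!: fsigma.cases)
  then show "fsigma_in euclidean S"
    using fsigma_in_Union[of "range F" euclidean] by (force intro: closed_imp_fsigma_in)
next
  assume "fsigma_in euclidean S"
  then show "fsigma S"
    by (auto simp: fsigma_in_ascending intro: fsigma.intros)
qed

lemma fsigma_UN:
  assumes "countable I" "\<And>i. i \<in> I \<Longrightarrow> fsigma (F i)"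
  shows "fsigma (\<Union>i\<in>I. F i)"
  using assms unfolding fsigma_iff_fsigma_in by (intro fsigma_in_Union) auto

lemma closed_imp_fsigma: "closed S \<Longrightarrow> fsigma S"
  by (simp add: fsigma_iff_fsigma_in closed_imp_fsigma_in)

lemma fsigma_imp_borel: "fsigma S \<Longrightarrow> S \<in> sets borel"
  by (auto elim!: fsigma.cases)

text \<open>  In a Heine-Borel space an \<open>F\<^sub>\<sigma>\<close> set is even a countable union of compact sets, which
  is why continuous images stay \<open>F\<^sub>\<sigma>\<close>. For general Borel sets this fails, and with it the
  measurability of functions defined as suprema.\<close>
lemma fsigma_continuous_image:
  fixes f :: "'a::{real_inner,heine_borel} \<Rightarrow> 'b::{real_inner,heine_borel}"
  assumes "fsigma S" "continuous_on UNIV f"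
  shows "fsigma (f ` S)"
proof -
  obtain K :: "nat \<Rightarrow> 'a set" where K: "\<And>n. compact (K n)" "S = \<Union>(range K)"
    using assms(1) unfolding fsigma_Union_compact by (metis image_subset_iff mem_Collect_eq UNIV_I)
  have "closed (f ` K n)" for n
    by (intro compact_imp_closed compact_continuous_image K continuous_on_subset[OF assms(2)]) auto
  moreover have "f ` S = (\<Union>n. f ` K n)"
    using K by auto
  ultimately show ?thesis
    by (simp add: fsigma.intros)
qed

lemma fsigma_Times:
  fixes S :: "'a::topological_space set" and T :: "'b::topological_space set"
  assumes "fsigma S" "fsigma T"
  shows "fsigma (S \<times> T)"
proof -
  obtain F :: "nat \<Rightarrow> 'a set" where F: "\<And>n. closed (F n)" "S = \<Union>(range F)"
    using assms(1) by (auto elim!: fsigma.cases)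
  obtain G :: "nat \<Rightarrow> 'b set" where G: "\<And>n. closed (G n)" "T = \<Union>(range G)"
    using assms(2) by (auto elim!: fsigma.cases)
  have "S \<times> T = (\<Union>p\<in>UNIV. F (fst p) \<times> G (snd p))"
    using F G by auto
  moreover have "fsigma (\<Union>p\<in>UNIV. F (fst p) \<times> G (snd p))"
    by (intro fsigma_UN closed_imp_fsigma closed_Times F G) auto
  ultimately show ?thesis by simp
qed

text \<open>  This class of Borel functions contains the upper semicontinuous ones and is closed under
  sup-convolution, an operation that does not preserve Borel measurability in general.\<close>
definition fsigma_superlevels :: "('a::topological_space \<Rightarrow> ennreal) \<Rightarrow> bool" where
  "fsigma_superlevels F \<longleftrightarrow> (\<forall>s. fsigma {x. s < F x})"

lemma borel_measurable_fsigma_superlevels: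
  "fsigma_superlevels F \<Longrightarrow> F \<in> borel_measurable borel"
  unfolding fsigma_superlevels_def
  by (intro borel_measurableI_greater) (auto dest: fsigma_imp_borel)

definition sup_conv :: "('a::ab_group_add \<Rightarrow> ennreal) \<Rightarrow> ('a \<Rightarrow> ennreal) \<Rightarrow> 'a \<Rightarrow> ennreal" where
  "sup_conv F G x = (SUP y. F y * G (x - y))"

definition reflect :: "('a::ab_group_add \<Rightarrow> ennreal) \<Rightarrow> 'a \<Rightarrow> ennreal" where
  "reflect F x = F (- x)"

lemma fsigma_superlevels_reflect:
  fixes F :: "'a::{real_inner,heine_borel} \<Rightarrow> ennreal"
  assumes "fsigma_superlevels F"
  shows "fsigma_superlevels (reflect F)"
  unfolding fsigma_superlevels_def
proof
  fix s
  have "{x. s < reflect F x} = uminus ` {x. s < F x}"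
    by (auto simp: reflect_def image_iff) (metis minus_minus)
  then show "fsigma {x. s < reflect F x}"
    using assms by (auto simp: fsigma_superlevels_def intro!: fsigma_continuous_image continuous_intros)
qed

text \<open>  The superlevel set of a product \<open>F y * G z\<close> becomes a countable union of products of
  superlevel sets once the two factors are separated by rational thresholds.\<close>
lemma less_mult_ennreal_rat:
  fixes a b s :: ennreal
  assumes "s < a * b"
  shows "\<exists>p q::rat. real_of_rat p < a \<and> real_of_rat q < b \<and> s < ennreal (real_of_rat p) * ennreal (real_of_rat q)"
proof -
  have approx: "\<exists>p::rat. real_of_rat p < a \<and> s < ennreal (real_of_rat p) * b" if "s < a * b" for a b :: ennreal
  proof -
    let ?Q = "{p::rat. ennreal (real_of_rat p) < a}"
    have "a \<noteq> 0" using that by auto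
    have "a = (SUP p\<in>?Q. ennreal (real_of_rat p))"
    proof (rule antisym)
      show "a \<le> (SUP p\<in>?Q. ennreal (real_of_rat p))"
      proof (rule ccontr)
        assume "\<not> ?thesis"
        then obtain r :: rat where r: "(SUP p\<in>?Q. ennreal (real_of_rat p)) < real_of_rat r" "real_of_rat r < a"
          using ennreal_rat_dense by (metis not_le)
        then show False
          by (metis (mono_tags, lifting) SUP_upper leD mem_Collect_eq)
      qed
    qed (auto intro!: SUP_least)
    then have "a * b = (SUP p\<in>?Q. ennreal (real_of_rat p) * b)"
      by (metis (no_types, lifting) SUP_mult_right_ennreal image_cong)
    with that show ?thesis
      by (auto simp: less_SUP_iff)
  qed
  obtain p :: rat where p: "real_of_rat p < a" "s < ennreal (real_of_rat p) * b"
    using approx assms by blast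
  obtain q :: rat where q: "real_of_rat q < b" "s < ennreal (real_of_rat q) * ennreal (real_of_rat p)"
    using approx[of b "ennreal (real_of_rat p)"] p by (auto simp: mult.commute)
  show ?thesis
    using p q by (auto simp: mult.commute)
qed

lemma fsigma_superlevels_sup_conv:
  fixes F G :: "'a::euclidean_space \<Rightarrow> ennreal"
  assumes "fsigma_superlevels F" "fsigma_superlevels G"
  shows "fsigma_superlevels (sup_conv F G)"
  unfolding fsigma_superlevels_def
proof
  fix s
  let ?I = "{(p::rat, q::rat). s < ennreal (real_of_rat p) * ennreal (real_of_rat q)}"
  let ?S = "\<Union>i\<in>?I. {y. ennreal (real_of_rat (fst i)) < F y} \<times> {z. ennreal (real_of_rat (snd i)) < G z}"
  have "{x. s < sup_conv F G x} = (\<lambda>(y, z). y + z) ` ?S"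
  proof (intro set_eqI iffI)
    fix x assume "x \<in> {x. s < sup_conv F G x}"
    then obtain y where "s < F y * G (x - y)"
      by (auto simp: sup_conv_def less_SUP_iff)
    then obtain p q :: rat where "real_of_rat p < F y" "real_of_rat q < G (x - y)"
        "s < ennreal (real_of_rat p) * ennreal (real_of_rat q)"
      using less_mult_ennreal_rat by blast
    then have "(y, x - y) \<in> ?S"
      by auto
    then show "x \<in> (\<lambda>(y, z). y + z) ` ?S"
      by (intro image_eqI[of _ _ "(y, x - y)"]) auto
  next
    fix x assume "x \<in> (\<lambda>(y, z). y + z) ` ?S"
    then obtain y z and p q :: rat where *: "x = y + z" "real_of_rat p < F y" "real_of_rat q < G z"
        "s < ennreal (real_of_rat p) * ennreal (real_of_rat q)"
      by auto
    have "s < ennreal (real_of_rat p) * ennreal (real_of_rat q)"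
      by (fact *)
    also have "\<dots> \<le> F y * G z"
      using * by (intro mult_mono) (auto intro: less_imp_le)
    finally have "s < F y * G (x - y)"
      using * by simp
    then show "x \<in> {x. s < sup_conv F G x}"
      by (auto simp: sup_conv_def less_SUP_iff)
  qed
  moreover have "fsigma ?S"
    using assms by (intro fsigma_UN fsigma_Times) (auto simp: fsigma_superlevels_def)
  ultimately show "fsigma {x. s < sup_conv F G x}"
    by (auto intro!: fsigma_continuous_image continuous_intros simp: case_prod_beta)
qed



section \<open>The Prekopa-Leindler inequality\<close>

lemma emeasure_lborel_translate:
  fixes S :: "'a::euclidean_space set"
  assumes "S \<in> sets borel"
  shows "(+) a ` S \<in> sets borel" "emeasure lborel ((+) a ` S) = emeasure lborel S"
proof -
  have eq: "(+) a ` S = (+) (- a) -` S \<inter> space borel"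
    by (auto simp: image_iff) (metis add_diff_cancel_left' diff_add_cancel add.commute)
  show borel: "(+) a ` S \<in> sets borel"
    unfolding eq by (rule measurable_sets[OF _ assms]) simp
  have "emeasure lborel ((+) a ` S) = emeasure (distr lborel borel ((+) a)) ((+) a ` S)"
    by (simp add: lborel_distr_plus)
  also have "\<dots> = emeasure lborel ((+) a -` (+) a ` S)"
    using borel by (simp add: emeasure_distr)
  also have "(+) a -` (+) a ` S = S"
    by (rule inj_vimage_image_eq) simp
  finally show "emeasure lborel ((+) a ` S) = emeasure lborel S" .
qed

text \<open>  For \<open>a\<close> close to \<open>Sup A\<close> and \<open>b\<close> close to \<open>Inf B\<close>, the translates \<open>A + b\<close> and \<open>a + B\<close> lie in
  the sumset side by side: they overlap in a set of length at most \<open>e\<close>.\<close>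
lemma emeasure_lborel_sumset_real_bounded:
  fixes A B C :: "real set"
  assumes A: "A \<in> sets borel" "A \<noteq> {}" "bdd_above A"
    and B: "B \<in> sets borel" "B \<noteq> {}" "bdd_below B"
    and C: "C \<in> sets borel" and sub: "\<And>a b. a \<in> A \<Longrightarrow> b \<in> B \<Longrightarrow> a + b \<in> C"
  shows "emeasure lborel A + emeasure lborel B \<le> emeasure lborel C"
proof (rule ennreal_le_epsilon)
  fix e :: real assume "0 < e"
  obtain a where a: "a \<in> A" "Sup A - e / 2 < a"
    using less_cSupE[of "Sup A - e / 2" A] A \<open>0 < e\<close> by auto
  obtain b where b: "b \<in> B" "b < Inf B + e / 2"
    using cInf_lessD[of B "Inf B + e / 2"] B \<open>0 < e\<close> by auto
  let ?P = "(+) b ` A" and ?Q = "(+) a ` B"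
  note tr = emeasure_lborel_translate[OF A(1), of b] emeasure_lborel_translate[OF B(1), of a]
  have "?P \<inter> ?Q \<subseteq> {a + Inf B..b + Sup A}"
  proof (intro subsetI, elim IntE imageE)
    fix x y z assume "x = b + y" "y \<in> A" "x = a + z" "z \<in> B"
    then show "x \<in> {a + Inf B..b + Sup A}"
      using cSup_upper[of y A] cInf_lower[of z B] A B by simp
  qed
  then have "emeasure lborel (?P \<inter> ?Q) \<le> emeasure lborel {a + Inf B..b + Sup A}"
    by (intro emeasure_mono) auto
  also have "\<dots> \<le> ennreal e"
    using a b \<open>0 < e\<close> by (auto simp: emeasure_lborel_Icc_eq intro!: ennreal_leI)
  finally have overlap: "emeasure lborel (?P \<inter> ?Q) \<le> ennreal e" .
  have "emeasure lborel A + emeasure lborel B = emeasure lborel (?P \<union> ?Q) + emeasure lborel (?P \<inter> ?Q)"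
    using tr by (subst emeasure_Un_Int[symmetric]) auto
  also have "\<dots> \<le> emeasure lborel C + ennreal e"
  proof (intro add_mono overlap emeasure_mono)
    show "?P \<union> ?Q \<subseteq> C"
      using sub a b by (auto simp: add.commute[of b])
  qed (use C in simp)
  finally show "emeasure lborel A + emeasure lborel B \<le> emeasure lborel C + ennreal e" .
qed

text \<open>  The Brunn-Minkowski inequality on the line; truncation reduces it to the bounded case.\<close>
lemma emeasure_lborel_sumset_real:
  fixes A B C :: "real set"
  assumes A: "A \<in> sets borel" "A \<noteq> {}" and B: "B \<in> sets borel" "B \<noteq> {}"
    and C: "C \<in> sets borel" and sub: "\<And>a b. a \<in> A \<Longrightarrow> b \<in> B \<Longrightarrow> a + b \<in> C"
  shows "emeasure lborel A + emeasure lborel B \<le> emeasure lborel C"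
proof -
  obtain a b where ab: "a \<in> A" "b \<in> B"
    using A B by auto
  define A' where "A' n = A \<inter> {..a + real n}" for n
  define B' where "B' n = B \<inter> {b - real n..}" for n
  have inc: "incseq A'" "incseq B'"
    by (auto simp: A'_def B'_def incseq_def)
  have [measurable]: "A' n \<in> sets borel" "B' n \<in> sets borel" for n
    using A B by (auto simp: A'_def B'_def)
  have UA: "A = (\<Union>n. A' n)"
  proof -
    have "\<exists>n. x \<le> a + real n" for x
      using real_arch_simple[of "x - a"] by (auto simp: algebra_simps)
    then show ?thesis by (auto simp: A'_def)
  qed
  have UB: "B = (\<Union>n. B' n)"
  proof -
    have "\<exists>n. b - real n \<le> x" for x
      using real_arch_simple[of "b - x"] by (auto simp: algebra_simps)
    then show ?thesis by (auto simp: B'_def)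
  qed
  have "emeasure lborel A + emeasure lborel B = (SUP n. emeasure lborel (A' n)) + (SUP n. emeasure lborel (B' n))"
    using inc by (subst (1 2) SUP_emeasure_incseq) (auto simp: UA[symmetric] UB[symmetric])
  also have "\<dots> = (SUP n. emeasure lborel (A' n) + emeasure lborel (B' n))"
    using inc by (intro ennreal_SUP_add[symmetric] incseq_emeasure) auto
  also have "\<dots> \<le> emeasure lborel C"
  proof (rule SUP_least)
    fix n
    show "emeasure lborel (A' n) + emeasure lborel (B' n) \<le> emeasure lborel C"
      using ab C sub by (intro emeasure_lborel_sumset_real_bounded) (auto simp: A'_def B'_def intro!: sets.Int A B)
  qed
  finally show ?thesis .
qed

lemma nn_integral_layer_cake:
  fixes f :: "'a \<Rightarrow> ennreal"
  assumes "sigma_finite_measure M" and [measurable]: "f \<in> borel_measurable M"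
  shows "(\<integral>\<^sup>+x. f x \<partial>M) = (\<integral>\<^sup>+t. emeasure M {x \<in> space M. ennreal t < f x} * indicator {0..} t \<partial>lborel)"
proof -
  interpret pair_sigma_finite M lborel
    using assms(1) lborel.sigma_finite_measure_axioms by (simp add: pair_sigma_finite_def)
  have level: "(\<integral>\<^sup>+t. indicator {t. 0 \<le> t \<and> ennreal t < c} t \<partial>lborel) = c" for c
  proof (cases c)
    case (real r)
    then have "{t. 0 \<le> t \<and> ennreal t < c} = {0..<r}"
      by (auto simp: ennreal_less_iff)
    with real show ?thesis by simp
  next
    case top
    then have "{t. 0 \<le> t \<and> ennreal t < c} = {0..}"
      by auto
    moreover have "(top::ennreal) \<le> emeasure lborel {0::real..}"
      unfolding ennreal_SUP_of_nat_eq_top[symmetric]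
    proof (rule SUP_least)
      fix n :: nat
      have "emeasure lborel {0..<real n} \<le> emeasure lborel {0::real..}"
        by (intro emeasure_mono) auto
      then show "of_nat n \<le> emeasure lborel {0::real..}"
        by (simp add: ennreal_of_nat_eq_real_of_nat)
    qed
    ultimately show ?thesis using top by (simp add: top_unique)
  qed
  have "(\<integral>\<^sup>+x. f x \<partial>M) = (\<integral>\<^sup>+x. \<integral>\<^sup>+t. indicator {t. 0 \<le> t \<and> ennreal t < f x} t \<partial>lborel \<partial>M)"
    by (simp only: level)
  also have "\<dots> = (\<integral>\<^sup>+t. \<integral>\<^sup>+x. indicator {t. 0 \<le> t \<and> ennreal t < f x} t \<partial>M \<partial>lborel)"
    by (rule Fubini'[symmetric]) (simp add: indicator_def case_prod_beta)
  also have "\<dots> = (\<integral>\<^sup>+t. emeasure M {x \<in> space M. ennreal t < f x} * indicator {0..} t \<partial>lborel)"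
  proof (rule nn_integral_cong)
    fix t :: real
    show "(\<integral>\<^sup>+x. indicator {t. 0 \<le> t \<and> ennreal t < f x} t \<partial>M) = emeasure M {x \<in> space M. ennreal t < f x} * indicator {0..} t"
    proof (cases "0 \<le> t")
      case True
      have "(\<integral>\<^sup>+x. indicator {t. 0 \<le> t \<and> ennreal t < f x} t \<partial>M) = (\<integral>\<^sup>+x. indicator {x \<in> space M. ennreal t < f x} x \<partial>M)"
        using True by (intro nn_integral_cong) (auto simp: indicator_def)
      with True show ?thesis by simp
    qed simp
  qed
  finally show ?thesis .
qed


lemma ennreal_less_of_square_gt:
  fixes c :: ennreal and t :: real
  assumes "0 \<le> t" "ennreal t < a" "ennreal t < b" "a * b \<le> c\<^sup>2"
  shows "ennreal t < c"
proof (rule ccontr)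
  assume "\<not> ennreal t < c"
  then have c: "c \<le> ennreal t" by simp
  obtain a' where a': "ennreal t < ennreal a'" "ennreal a' < a" "0 \<le> a'"
    using ennreal_rat_dense[OF assms(2)] by (metis ennreal_neg linorder_le_cases not_less_zero)
  obtain b' where b': "ennreal t < ennreal b'" "ennreal b' < b" "0 \<le> b'"
    using ennreal_rat_dense[OF assms(3)] by (metis ennreal_neg linorder_le_cases not_less_zero)
  have "t * t < a' * b'"
    using a' b' assms(1) by (intro mult_strict_mono) (auto simp: ennreal_less_iff)
  then have "ennreal t * ennreal t < ennreal a' * ennreal b'"
    using assms(1) a' b' by (simp add: ennreal_mult[symmetric] ennreal_less_iff)
  also have "\<dots> \<le> a * b"
    using a' b' by (intro mult_mono) (auto intro: less_imp_le)
  also have "\<dots> \<le> c\<^sup>2" by fact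
  also have "\<dots> \<le> ennreal t * ennreal t"
    using c by (auto simp: power2_eq_square intro: mult_mono)
  finally show False by simp
qed

text \<open>  When both suprema are \<open>1\<close>, the levels of \<open>f\<close> and \<open>g\<close> at any height below \<open>1\<close> are nonempty, and
  their sumset lies in the level of \<open>h\<close> at the same height. The one-dimensional
  Brunn-Minkowski inequality for these levels is then integrated over the height.\<close>
lemma prekopa_leindler_real_normalized:
  fixes f g h :: "real \<Rightarrow> ennreal"
  assumes [measurable]: "f \<in> borel_measurable borel" "g \<in> borel_measurable borel" "h \<in> borel_measurable borel"
    and sup: "(SUP x. f x) = 1" "(SUP x. g x) = 1"
    and le: "\<And>x y. f x * g y \<le> (h (x + y))\<^sup>2"
  shows "(\<integral>\<^sup>+x. f x \<partial>lborel) + (\<integral>\<^sup>+x. g x \<partial>lborel) \<le> (\<integral>\<^sup>+x. h x \<partial>lborel)"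
proof -
  let ?L = "\<lambda>u::real \<Rightarrow> ennreal. \<lambda>t. emeasure lborel {x. ennreal t < u x} * indicator {0::real..} t"
  have cake: "(\<integral>\<^sup>+x. u x \<partial>lborel) = (\<integral>\<^sup>+t. ?L u t \<partial>lborel)"
    if "u \<in> borel_measurable borel" for u
    using nn_integral_layer_cake[of lborel u] that by (simp add: lborel.sigma_finite_measure_axioms)
  have meas: "?L u \<in> borel_measurable borel" if [measurable]: "u \<in> borel_measurable borel" for u
  proof -
    have "(\<lambda>t. emeasure lborel {x \<in> space lborel. ennreal t < u x}) \<in> borel_measurable borel"
      by measurable
    then show ?thesis by simp
  qed
  have level: "?L f t + ?L g t \<le> ?L h t" for t
  proof (cases "0 \<le> t \<and> t < 1")
    case True
    then have "ennreal t < (SUP x. f x)" "ennreal t < (SUP x. g x)"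
      unfolding sup by (simp_all add: ennreal_less_one_iff)
    then have "{x. ennreal t < f x} \<noteq> {}" "{x. ennreal t < g x} \<noteq> {}"
      by (auto simp: less_SUP_iff)
    then have "emeasure lborel {x. ennreal t < f x} + emeasure lborel {x. ennreal t < g x}
        \<le> emeasure lborel {x. ennreal t < h x}"
      using True le by (intro emeasure_lborel_sumset_real) (auto intro: ennreal_less_of_square_gt)
    with True show ?thesis by simp
  next
    case False
    have "f x \<le> 1" "g x \<le> 1" for x
      using SUP_upper[of x UNIV f] SUP_upper[of x UNIV g] sup by auto
    then have "\<not> ennreal t < f x" "\<not> ennreal t < g x" if "1 \<le> t" for x
      using that order.trans[of _ 1 "ennreal t"] by (auto simp: not_less)
    then show ?thesis
      using False by (cases "0 \<le> t") auto
  qed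
  show ?thesis
    unfolding cake[OF assms(1)] cake[OF assms(2)] cake[OF assms(3)]
    by (subst nn_integral_add[symmetric]) (auto intro!: nn_integral_mono level meas)
qed

lemma ennreal_four_mult_le_square_add: "4 * (a * b) \<le> (a + b)\<^sup>2" for a b :: ennreal
proof (cases "a = top \<or> b = top")
  case True
  then show ?thesis by (auto simp: power2_eq_square ennreal_mult_top ennreal_top_mult)
next
  case False
  then obtain r s where rs: "a = ennreal r" "b = ennreal s" "0 \<le> r" "0 \<le> s"
    by (metis ennreal_cases)
  have "4 * (r * s) \<le> (r + s)\<^sup>2"
    using zero_le_power2[of "r - s"] by (simp add: power2_eq_square algebra_simps)
  then have "ennreal (4 * (r * s)) \<le> ennreal ((r + s)\<^sup>2)"
    by (rule ennreal_leI)
  also have "ennreal (4 * (r * s)) = 4 * (a * b)"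
    using rs by (simp add: ennreal_mult')
  also have "ennreal ((r + s)\<^sup>2) = (a + b)\<^sup>2"
    using rs by (simp add: ennreal_power flip: ennreal_plus)
  finally show ?thesis .
qed

text \<open>  Scaling the suprema \<open>r\<close> and \<open>s\<close> of \<open>f\<close> and \<open>g\<close> to \<open>1\<close>, with the matching factor
  \<open>1 / sqrt (r * s)\<close> for \<open>h\<close>, gives a sum of integrals, which the inequality between arithmetic
  and geometric mean turns into a product.\<close>
lemma prekopa_leindler_real_bounded:
  fixes f g h :: "real \<Rightarrow> ennreal"
  assumes [measurable]: "f \<in> borel_measurable borel" "g \<in> borel_measurable borel" "h \<in> borel_measurable borel"
    and bounded: "(SUP x. f x) < top" "(SUP x. g x) < top"
    and le: "\<And>x y. f x * g y \<le> (h (x + y))\<^sup>2"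
  shows "4 * ((\<integral>\<^sup>+x. f x \<partial>lborel) * (\<integral>\<^sup>+x. g x \<partial>lborel)) \<le> (\<integral>\<^sup>+x. h x \<partial>lborel)\<^sup>2"
proof (cases "(SUP x. f x) = 0 \<or> (SUP x. g x) = 0")
  case True
  then have "(\<forall>x. f x = 0) \<or> (\<forall>x. g x = 0)"
    by (metis SUP_upper UNIV_I le_zero_eq)
  then show ?thesis by auto
next
  case False
  obtain r where r: "(SUP x. f x) = ennreal r" "0 < r"
    using False bounded by (cases "SUP x. f x") (auto simp: less_le)
  obtain s where s: "(SUP x. g x) = ennreal s" "0 < s"
    using False bounded by (cases "SUP x. g x") (auto simp: less_le)
  define k where "k = sqrt (r * s)"
  have k: "0 < k" "k\<^sup>2 = r * s"
    using r s by (simp_all add: k_def)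
  let ?F = "\<integral>\<^sup>+x. f x \<partial>lborel" and ?G = "\<integral>\<^sup>+x. g x \<partial>lborel" and ?H = "\<integral>\<^sup>+x. h x \<partial>lborel"
  have "(\<integral>\<^sup>+x. ennreal (1 / r) * f x \<partial>lborel) + (\<integral>\<^sup>+x. ennreal (1 / s) * g x \<partial>lborel)
      \<le> (\<integral>\<^sup>+x. ennreal (1 / k) * h x \<partial>lborel)"
  proof (rule prekopa_leindler_real_normalized)
    show "(SUP x. ennreal (1 / r) * f x) = 1" "(SUP x. ennreal (1 / s) * g x) = 1"
      using r s by (simp_all add: SUP_mult_left_ennreal[symmetric] flip: ennreal_mult')
    fix x y
    have "ennreal (1 / r) * f x * (ennreal (1 / s) * g y) = ennreal (1 / (r * s)) * (f x * g y)"
      using r s by (simp add: ennreal_mult[symmetric] mult.assoc mult.left_commute flip: mult.assoc) (simp add: ac_simps)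
    also have "\<dots> \<le> ennreal (1 / (r * s)) * (h (x + y))\<^sup>2"
      by (intro mult_left_mono le) simp
    also have "ennreal (1 / (r * s)) = (ennreal (1 / k))\<^sup>2"
      using k by (simp add: ennreal_power power_divide)
    finally show "ennreal (1 / r) * f x * (ennreal (1 / s) * g y) \<le> (ennreal (1 / k) * h (x + y))\<^sup>2"
      by (simp add: power_mult_distrib)
  qed simp_all
  then have sum: "ennreal (1 / r) * ?F + ennreal (1 / s) * ?G \<le> ennreal (1 / k) * ?H"
    by (simp add: nn_integral_cmult)
  have "4 * (?F * ?G) = ennreal (r * s) * (4 * ((ennreal (1 / r) * ?F) * (ennreal (1 / s) * ?G)))"
  proof -
    have "ennreal (r * s) * (4 * ((ennreal (1 / r) * ?F) * (ennreal (1 / s) * ?G)))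
        = (ennreal (r * s) * ennreal (1 / r) * ennreal (1 / s)) * (4 * (?F * ?G))"
      by (simp add: ac_simps)
    also have "ennreal (r * s) * ennreal (1 / r) * ennreal (1 / s) = 1"
      using r s by (simp add: ennreal_mult[symmetric])
    finally show ?thesis by simp
  qed
  also have "\<dots> \<le> ennreal (r * s) * (ennreal (1 / r) * ?F + ennreal (1 / s) * ?G)\<^sup>2"
    by (intro mult_left_mono ennreal_four_mult_le_square_add) simp
  also have "\<dots> \<le> ennreal (r * s) * (ennreal (1 / k) * ?H)\<^sup>2"
    by (intro mult_left_mono power_mono_ennreal sum) simp
  also have "\<dots> = (ennreal (r * s) * (ennreal (1 / k))\<^sup>2) * ?H\<^sup>2"
    by (simp add: power_mult_distrib mult.assoc)
  also have "ennreal (r * s) * (ennreal (1 / k))\<^sup>2 = 1"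
    using k r s by (simp add: ennreal_power ennreal_mult[symmetric] power_divide)
  finally show ?thesis by simp
qed

lemma prekopa_leindler_real:
  fixes f g h :: "real \<Rightarrow> ennreal"
  assumes [measurable]: "f \<in> borel_measurable borel" "g \<in> borel_measurable borel" "h \<in> borel_measurable borel"
    and le: "\<And>x y. f x * g y \<le> (h (x + y))\<^sup>2"
  shows "4 * ((\<integral>\<^sup>+x. f x \<partial>lborel) * (\<integral>\<^sup>+x. g x \<partial>lborel)) \<le> (\<integral>\<^sup>+x. h x \<partial>lborel)\<^sup>2"
proof -
  have trunc: "(\<integral>\<^sup>+x. u x \<partial>lborel) = (SUP n::nat. \<integral>\<^sup>+x. min (u x) (of_nat n) \<partial>lborel)"
    if [measurable]: "u \<in> borel_measurable borel" for u :: "real \<Rightarrow> ennreal"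
  proof -
    have "u x = (SUP n::nat. min (u x) (of_nat n))" for x
      by (simp add: inf_min[symmetric] inf_SUP[symmetric] ennreal_SUP_of_nat_eq_top)
    then have "(\<integral>\<^sup>+x. u x \<partial>lborel) = (\<integral>\<^sup>+x. (SUP n::nat. min (u x) (of_nat n)) \<partial>lborel)"
      by simp
    also have "\<dots> = (SUP n::nat. \<integral>\<^sup>+x. min (u x) (of_nat n) \<partial>lborel)"
      by (rule nn_integral_monotone_convergence_SUP)
         (auto simp: incseq_def le_fun_def intro: min.coboundedI2)
    finally show ?thesis .
  qed
  have "4 * ((\<integral>\<^sup>+x. min (f x) (of_nat m) \<partial>lborel) * (\<integral>\<^sup>+x. min (g x) (of_nat n) \<partial>lborel))
      \<le> (\<integral>\<^sup>+x. h x \<partial>lborel)\<^sup>2" for m n :: nat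
  proof (rule prekopa_leindler_real_bounded)
    have "(SUP x. min (u x) (of_nat n)) \<le> of_nat n" for u :: "real \<Rightarrow> ennreal" and n
      by (rule SUP_least) simp
    then show "(SUP x. min (f x) (of_nat m)) < top" "(SUP x. min (g x) (of_nat n)) < top"
      by (metis le_less_trans of_nat_less_top)+
    show "min (f x) (of_nat m) * min (g y) (of_nat n) \<le> (h (x + y))\<^sup>2" for x y
      by (rule order.trans[OF mult_mono le]) auto
  qed measurable
  then show ?thesis
    unfolding trunc[OF assms(1)] trunc[OF assms(2)]
    by (simp add: SUP_mult_left_ennreal SUP_mult_right_ennreal SUP_le_iff)
qed


text \<open>  The hypothesis survives integration over all but one coordinate: by the induction hypothesis the
  marginals satisfy it again, up to the factor \<open>4 ^ card I\<close>, and the one-dimensional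
  inequality applies to them. Working over an arbitrary finite index set makes the
  induction on the dimension possible.\<close>
lemma prekopa_leindler_PiM:
  fixes f g h :: "('i \<Rightarrow> real) \<Rightarrow> ennreal"
  assumes "finite I"
    and "f \<in> borel_measurable (PiM I (\<lambda>_. lborel))" "g \<in> borel_measurable (PiM I (\<lambda>_. lborel))"
      "h \<in> borel_measurable (PiM I (\<lambda>_. lborel))"
    and "\<And>x y. x \<in> extensional I \<Longrightarrow> y \<in> extensional I \<Longrightarrow> f x * g y \<le> (h (\<lambda>i\<in>I. x i + y i))\<^sup>2"
  shows "4 ^ card I * ((\<integral>\<^sup>+x. f x \<partial>PiM I (\<lambda>_. lborel)) * (\<integral>\<^sup>+x. g x \<partial>PiM I (\<lambda>_. lborel)))
    \<le> (\<integral>\<^sup>+x. h x \<partial>PiM I (\<lambda>_. lborel))\<^sup>2"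
  using assms
proof (induction I arbitrary: f g h rule: finite_induct)
  case empty
  have "f (\<lambda>_. undefined) * g (\<lambda>_. undefined) \<le> (h (\<lambda>_. undefined))\<^sup>2"
    using empty(4)[of "\<lambda>_. undefined" "\<lambda>_. undefined"] by (simp add: restrict_def)
  then show ?case
    by (simp add: PiM_empty nn_integral_count_space_finite)
next
  case (insert i I)
  interpret product_sigma_finite "\<lambda>_. lborel :: real measure"
    by standard
  let ?M = "PiM I (\<lambda>_. lborel :: real measure)"
  define slice where "slice u t = (\<integral>\<^sup>+x. u (x(i := t)) \<partial>?M)" for u :: "('i \<Rightarrow> real) \<Rightarrow> ennreal" and t
  have int: "(\<integral>\<^sup>+x. u x \<partial>PiM (insert i I) (\<lambda>_. lborel)) = (\<integral>\<^sup>+t. slice u t \<partial>lborel)"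
    if "u \<in> borel_measurable (PiM (insert i I) (\<lambda>_. lborel))" for u
    using product_nn_integral_insert_rev[OF insert(1,2) that] by (simp add: slice_def)
  have meas: "slice u \<in> borel_measurable borel" and meas': "(\<lambda>x. u (x(i := t))) \<in> borel_measurable ?M"
    if [measurable]: "u \<in> borel_measurable (PiM (insert i I) (\<lambda>_. lborel))" for u t
  proof -
    interpret sigma_finite_measure ?M
      by (rule sigma_finite) (rule insert)
    have "(\<lambda>t. \<integral>\<^sup>+x. u (x(i := t)) \<partial>?M) \<in> borel_measurable lborel"
      by measurable
    then show "slice u \<in> borel_measurable borel"
      by (simp add: slice_def[abs_def])
    show "(\<lambda>x. u (x(i := t))) \<in> borel_measurable ?M"
      by measurable
  qed
  have "4 ^ card I * (slice f s * slice g t) \<le> (slice h (s + t))\<^sup>2" for s t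
    unfolding slice_def
  proof (rule insert.IH)
    fix x y :: "'i \<Rightarrow> real" assume xy: "x \<in> extensional I" "y \<in> extensional I"
    have "(\<lambda>j\<in>insert i I. (x(i := s)) j + (y(i := t)) j) = (\<lambda>j\<in>I. x j + y j)(i := s + t)"
      using \<open>i \<notin> I\<close> by (auto simp: restrict_def)
    moreover have "x(i := s) \<in> extensional (insert i I)" "y(i := t) \<in> extensional (insert i I)"
      using xy by (auto simp: extensional_def)
    ultimately show "f (x(i := s)) * g (y(i := t)) \<le> (h ((\<lambda>j\<in>I. x j + y j)(i := s + t)))\<^sup>2"
      using insert.prems(4)[of "x(i := s)" "y(i := t)"] by (simp only:)
  qed (intro meas' insert.prems)+
  then have "4 * ((\<integral>\<^sup>+t. 4 ^ card I * slice f t \<partial>lborel) * (\<integral>\<^sup>+t. slice g t \<partial>lborel)) \<le> (\<integral>\<^sup>+t. slice h t \<partial>lborel)\<^sup>2"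
    using meas[OF insert.prems(1)] meas[OF insert.prems(2)] meas[OF insert.prems(3)]
    by (intro prekopa_leindler_real) (simp_all add: mult.assoc)
  then show ?case
    using insert meas[OF insert.prems(1)] by (simp add: int nn_integral_cmult mult.assoc)
qed

text \<open>  The Prekopa-Leindler inequality with equal weights, without square roots: \<open>x + y\<close> takes the place
  of the midpoint, which is where the factor \<open>4 ^ DIM('a)\<close> comes from.\<close>
theorem prekopa_leindler:
  fixes f g h :: "'a::euclidean_space \<Rightarrow> ennreal"
  assumes [measurable]: "f \<in> borel_measurable borel" "g \<in> borel_measurable borel" "h \<in> borel_measurable borel"
    and le: "\<And>x y. f x * g y \<le> (h (x + y))\<^sup>2"
  shows "4 ^ DIM('a) * ((\<integral>\<^sup>+x. f x \<partial>lborel) * (\<integral>\<^sup>+x. g x \<partial>lborel)) \<le> (\<integral>\<^sup>+x. h x \<partial>lborel)\<^sup>2"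
proof -
  define T :: "('a \<Rightarrow> real) \<Rightarrow> 'a" where "T x = (\<Sum>b\<in>Basis. x b *\<^sub>R b)" for x
  have [measurable]: "T \<in> PiM Basis (\<lambda>_. lborel) \<rightarrow>\<^sub>M borel"
    unfolding T_def[abs_def] by measurable
  have int: "(\<integral>\<^sup>+x. u x \<partial>lborel) = (\<integral>\<^sup>+x. u (T x) \<partial>PiM Basis (\<lambda>_. lborel))"
    if [measurable]: "u \<in> borel_measurable borel" for u :: "'a \<Rightarrow> ennreal"
    by (subst lborel_eq) (simp add: nn_integral_distr T_def)
  have "T (\<lambda>i\<in>Basis. x i + y i) = T x + T y" for x y
    by (simp add: T_def scaleR_add_left sum.distrib)
  then show ?thesis
    using le unfolding int[OF assms(1)] int[OF assms(2)] int[OF assms(3)]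
    by (intro prekopa_leindler_PiM) simp_all
qed

lemma nn_integral_lborel_affine:
  fixes f :: "'a::euclidean_space \<Rightarrow> ennreal"
  assumes [measurable]: "f \<in> borel_measurable borel" and c: "c \<noteq> 0"
  shows "(\<integral>\<^sup>+x. f x \<partial>lborel) = ennreal (\<bar>c\<bar> ^ DIM('a)) * (\<integral>\<^sup>+x. f (t + c *\<^sub>R x) \<partial>lborel)"
  by (subst lborel_affine[OF c, of t]) (simp add: nn_integral_density nn_integral_distr nn_integral_cmult)

section \<open>Difference functions of log-concave functions\<close>

text \<open>  The functional form of \<open>vol (K - K) \<ge> 2 ^ n * vol K\<close>: the Prekopa-Leindler inequality for \<open>w\<^sup>2\<close>
  and its reflection, which have the same integral.\<close>
lemma nn_integral_difference_function_ge:
  fixes w E :: "'a::euclidean_space \<Rightarrow> ennreal"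
  assumes [measurable]: "w \<in> borel_measurable borel" "E \<in> borel_measurable borel"
    and le: "\<And>a b. w a * w b \<le> E (a - b)"
  shows "2 ^ DIM('a) * (\<integral>\<^sup>+x. (w x)\<^sup>2 \<partial>lborel) \<le> (\<integral>\<^sup>+x. E x \<partial>lborel)"
proof -
  let ?W = "\<integral>\<^sup>+x. (w x)\<^sup>2 \<partial>lborel"
  have "?W = (\<integral>\<^sup>+x. (w (- x))\<^sup>2 \<partial>lborel)"
    using nn_integral_lborel_affine[of "\<lambda>x. (w x)\<^sup>2" "-1" 0] by simp
  moreover have "4 ^ DIM('a) * (?W * (\<integral>\<^sup>+x. (w (- x))\<^sup>2 \<partial>lborel)) \<le> (\<integral>\<^sup>+x. E x \<partial>lborel)\<^sup>2"
  proof (rule prekopa_leindler)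
    fix a b
    have "(w a * w (- b))\<^sup>2 \<le> (E (a - (- b)))\<^sup>2"
      by (intro power_mono_ennreal le)
    then show "(w a)\<^sup>2 * (w (- b))\<^sup>2 \<le> (E (a + b))\<^sup>2"
      by (simp add: power_mult_distrib)
  qed measurable
  ultimately have sq: "(2 ^ DIM('a) * ?W)\<^sup>2 \<le> (\<integral>\<^sup>+x. E x \<partial>lborel)\<^sup>2"
    by (simp add: power_mult_distrib power2_eq_square[of ?W] power_mult[symmetric] power2_eq_square[of "\<integral>\<^sup>+x. _ x \<partial>lborel"])
       (simp add: power_mult mult.commute[of "DIM('a)"] power2_eq_square)
  have "x \<le> y" if "x\<^sup>2 \<le> y\<^sup>2" for x y :: ennreal
  proof (rule ccontr)
    assume "\<not> x \<le> y"
    then obtain r :: rat where r: "y < ennreal (real_of_rat r)" "ennreal (real_of_rat r) < x"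
      using ennreal_rat_dense by (metis not_le)
    obtain s where s: "y = ennreal s" "0 \<le> s"
      using r by (cases y) auto
    then have "s < real_of_rat r"
      using r by (simp add: ennreal_less_iff)
    then have "s\<^sup>2 < (real_of_rat r)\<^sup>2"
      using s by (intro power_strict_mono) auto
    then have "y\<^sup>2 < (ennreal (real_of_rat r))\<^sup>2"
      using s \<open>s < real_of_rat r\<close> order.trans[of 0 s "real_of_rat r"]
      by (simp add: ennreal_power ennreal_less_iff del: zero_le_of_rat_iff)
    also have "\<dots> \<le> x\<^sup>2"
      using r by (intro power_mono_ennreal) simp
    finally show False
      using that by simp
  qed
  from this[OF sq] show ?thesis .
qed

definition midpoint_log_concave :: "('a::real_vector \<Rightarrow> ennreal) \<Rightarrow> bool" where
  "midpoint_log_concave F \<longleftrightarrow> (\<forall>x y. F x * F y \<le> (F (midpoint x y))\<^sup>2)"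

lemma midpoint_log_concave_reflect:
  assumes "midpoint_log_concave F"
  shows "midpoint_log_concave (reflect F)"
  using assms unfolding midpoint_log_concave_def reflect_def
  by (metis (no_types, lifting) midpoint_def minus_add_distrib scaleR_minus_right add.commute)

lemma midpoint_log_concave_sup_conv:
  assumes F: "midpoint_log_concave F" and G: "midpoint_log_concave G"
  shows "midpoint_log_concave (sup_conv F G)"
  unfolding midpoint_log_concave_def
proof (intro allI)
  fix x x'
  have "(F y * G (x - y)) * (F y' * G (x' - y')) \<le> (sup_conv F G (midpoint x x'))\<^sup>2" for y y'
  proof -
    have "(F y * G (x - y)) * (F y' * G (x' - y')) = (F y * F y') * (G (x - y) * G (x' - y'))"
      by (simp add: ac_simps)
    also have "\<dots> \<le> (F (midpoint y y'))\<^sup>2 * (G (midpoint (x - y) (x' - y')))\<^sup>2"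
      using F G by (intro mult_mono) (auto simp: midpoint_log_concave_def)
    also have "\<dots> = (F (midpoint y y') * G (midpoint x x' - midpoint y y'))\<^sup>2"
      by (simp add: power_mult_distrib midpoint_def algebra_simps)
    also have "\<dots> \<le> (sup_conv F G (midpoint x x'))\<^sup>2"
      unfolding sup_conv_def by (intro power_mono_ennreal SUP_upper) simp
    finally show ?thesis .
  qed
  then show "sup_conv F G x * sup_conv F G x' \<le> (sup_conv F G (midpoint x x'))\<^sup>2"
    unfolding sup_conv_def[of F G x] sup_conv_def[of F G x']
    by (simp add: SUP_mult_left_ennreal SUP_mult_right_ennreal SUP_le_iff)
qed

text \<open>  A functional Rogers-Shephard inequality. With \<open>H = h\<^sup>2\<close>, the integral of
  \<open>N x = \<integral> H a * H (a - x/2) da\<close> is \<open>2 ^ n * (\<integral> H)\<^sup>2\<close> by Fubini. On the other hand, midpoint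
  concavity at \<open>p\<close>, \<open>y\<close> and at \<open>p - x\<close>, \<open>y\<close> gives, for every \<open>y\<close>,
  \<open>h p * h (p - x) * H y \<le> H a * H (a - x/2)\<close> with \<open>a = (p + y) / 2\<close>. Integrating over \<open>y\<close> and
  taking the supremum over \<open>p\<close> bounds \<open>2 ^ n * N x\<close> from below by the difference function of \<open>h\<close>
  times \<open>\<integral> H\<close>.\<close>
lemma nn_integral_difference_function_le:
  fixes h :: "'a::euclidean_space \<Rightarrow> ennreal"
  assumes h: "midpoint_log_concave h" and fsigma: "fsigma_superlevels h"
  shows "(\<integral>\<^sup>+x. sup_conv h (reflect h) x \<partial>lborel) * (\<integral>\<^sup>+x. (h x)\<^sup>2 \<partial>lborel)
    \<le> 4 ^ DIM('a) * (\<integral>\<^sup>+x. (h x)\<^sup>2 \<partial>lborel)\<^sup>2"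
proof -
  have [measurable]: "h \<in> borel_measurable borel"
    using fsigma by (rule borel_measurable_fsigma_superlevels)
  have [measurable]: "sup_conv h (reflect h) \<in> borel_measurable borel"
    by (intro borel_measurable_fsigma_superlevels fsigma_superlevels_sup_conv fsigma_superlevels_reflect fsigma)
  let ?H = "\<integral>\<^sup>+x. (h x)\<^sup>2 \<partial>lborel"
  define N where "N x = (\<integral>\<^sup>+a. (h a)\<^sup>2 * (h (a - (1/2) *\<^sub>R x))\<^sup>2 \<partial>lborel)" for x
  have two: "ennreal ((1/2) ^ DIM('a)) * 2 ^ DIM('a) = 1"
    by (simp add: power_mult_distrib[symmetric] ennreal_mult[symmetric] ennreal_power flip: ennreal_numeral)
  have "sup_conv h (reflect h) x * ?H \<le> 2 ^ DIM('a) * N x" for x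
  proof -
    have "(h p * h (p - x)) * ?H \<le> 2 ^ DIM('a) * N x" for p
    proof -
      have pw: "(h p * h (p - x)) * (h y)\<^sup>2 \<le> (h ((1/2) *\<^sub>R p + (1/2) *\<^sub>R y))\<^sup>2 * (h ((1/2) *\<^sub>R p + (1/2) *\<^sub>R y - (1/2) *\<^sub>R x))\<^sup>2" for y
      proof -
        have "(h p * h (p - x)) * (h y)\<^sup>2 = (h p * h y) * (h (p - x) * h y)"
          by (simp add: power2_eq_square ac_simps)
        also have "\<dots> \<le> (h (midpoint p y))\<^sup>2 * (h (midpoint (p - x) y))\<^sup>2"
          using h by (intro mult_mono) (auto simp: midpoint_log_concave_def)
        finally show ?thesis
          by (simp add: midpoint_def algebra_simps)
      qed
      have "(h p * h (p - x)) * ?H = (\<integral>\<^sup>+y. (h p * h (p - x)) * (h y)\<^sup>2 \<partial>lborel)"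
        by (simp add: nn_integral_cmult)
      also have "\<dots> \<le> (\<integral>\<^sup>+y. (h ((1/2) *\<^sub>R p + (1/2) *\<^sub>R y))\<^sup>2 * (h ((1/2) *\<^sub>R p + (1/2) *\<^sub>R y - (1/2) *\<^sub>R x))\<^sup>2 \<partial>lborel)"
        by (intro nn_integral_mono pw)
      also have "\<dots> = 2 ^ DIM('a) * N x"
        unfolding N_def
        by (subst (2) nn_integral_lborel_affine[where c="1/2" and t="(1/2) *\<^sub>R p"])
           (simp_all add: mult.assoc[symmetric] two mult.commute[of "2 ^ DIM('a)"])
      finally show ?thesis .
    qed
    then show ?thesis
      by (simp add: sup_conv_def reflect_def SUP_mult_right_ennreal SUP_le_iff)
  qed
  then have "(\<integral>\<^sup>+x. sup_conv h (reflect h) x * ?H \<partial>lborel) \<le> (\<integral>\<^sup>+x. 2 ^ DIM('a) * N x \<partial>lborel)"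
    by (intro nn_integral_mono)
  moreover have "(\<integral>\<^sup>+x. N x \<partial>lborel) = 2 ^ DIM('a) * ?H\<^sup>2"
  proof -
    have "(\<integral>\<^sup>+x. N x \<partial>lborel) = (\<integral>\<^sup>+a. \<integral>\<^sup>+x. (h a)\<^sup>2 * (h (a - (1/2) *\<^sub>R x))\<^sup>2 \<partial>lborel \<partial>lborel)"
      unfolding N_def by (rule lborel_pair.Fubini') measurable
    also have "\<dots> = (\<integral>\<^sup>+a. (h a)\<^sup>2 * (2 ^ DIM('a) * ?H) \<partial>lborel)"
    proof (rule nn_integral_cong)
      fix a
      have "?H = ennreal ((1/2) ^ DIM('a)) * (\<integral>\<^sup>+x. (h (a - (1/2) *\<^sub>R x))\<^sup>2 \<partial>lborel)"
        using nn_integral_lborel_affine[of "\<lambda>x. (h x)\<^sup>2" "-1/2" a] by simp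
      then have "2 ^ DIM('a) * ?H = (ennreal ((1/2) ^ DIM('a)) * 2 ^ DIM('a)) * (\<integral>\<^sup>+x. (h (a - (1/2) *\<^sub>R x))\<^sup>2 \<partial>lborel)"
        by (simp add: ac_simps)
      then show "(\<integral>\<^sup>+x. (h a)\<^sup>2 * (h (a - (1/2) *\<^sub>R x))\<^sup>2 \<partial>lborel) = (h a)\<^sup>2 * (2 ^ DIM('a) * ?H)"
        by (simp add: nn_integral_cmult two)
    qed
    also have "\<dots> = 2 ^ DIM('a) * ?H\<^sup>2"
      by (subst nn_integral_multc) (simp_all add: power2_eq_square ac_simps)
    finally show ?thesis .
  qed
  moreover have "N \<in> borel_measurable borel"
    unfolding N_def[abs_def] by measurable
  moreover have "(4::ennreal) ^ DIM('a) = 2 ^ DIM('a) * 2 ^ DIM('a)"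
    by (simp add: power_mult_distrib[symmetric])
  ultimately show ?thesis
    by (simp add: nn_integral_cmult nn_integral_multc mult.assoc)
qed


section \<open>Sup-convolution with a function and with its reflection\<close>

text \<open>  The difference functions of \<open>A \<star> B\<close> and of \<open>A \<star> reflect B\<close> are suprema of the same
  products \<open>A y * B z * A y' * B z'\<close>, because \<open>(y + z) - (y' + z') = (y - z') - (y' - z)\<close>.\<close>
lemma sup_conv_self_mult_le:
  fixes A B :: "'a::ab_group_add \<Rightarrow> ennreal"
  shows "sup_conv A B a * sup_conv A B b
    \<le> sup_conv (sup_conv A (reflect B)) (reflect (sup_conv A (reflect B))) (a - b)"
    (is "_ \<le> sup_conv ?h _ _")
proof -
  have "(A y * B (a - y)) * (A y' * B (b - y')) \<le> sup_conv ?h (reflect ?h) (a - b)" for y y'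
  proof -
    let ?p = "y - (b - y')" and ?q = "y' - (a - y)"
    have p: "A y * B (b - y') \<le> ?h ?p"
      unfolding sup_conv_def reflect_def by (rule SUP_upper2[of y]) (simp_all add: algebra_simps)
    have q: "A y' * B (a - y) \<le> ?h ?q"
      unfolding sup_conv_def reflect_def by (rule SUP_upper2[of y']) (simp_all add: algebra_simps)
    have "(A y * B (a - y)) * (A y' * B (b - y')) = (A y * B (b - y')) * (A y' * B (a - y))"
      by (simp add: ac_simps)
    also have "\<dots> \<le> ?h ?p * ?h ?q"
      by (intro mult_mono p q) auto
    also have "\<dots> = ?h ?p * reflect ?h ((a - b) - ?p)"
      by (simp add: reflect_def algebra_simps)
    also have "\<dots> \<le> sup_conv ?h (reflect ?h) (a - b)"
      unfolding sup_conv_def[of ?h] by (intro SUP_upper) simp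
    finally show ?thesis .
  qed
  then show ?thesis
    unfolding sup_conv_def[of A B]
    by (simp add: SUP_mult_left_ennreal SUP_mult_right_ennreal SUP_le_iff)
qed

lemma sup_conv_pos_iff:
  fixes A B :: "'a::ab_group_add \<Rightarrow> ennreal"
  shows "0 < sup_conv A B x \<longleftrightarrow> (\<exists>y. 0 < A y \<and> 0 < B (x - y))"
  by (simp add: sup_conv_def less_SUP_iff ennreal_zero_less_mult_iff)

text \<open>  The degenerate case, in which the Rogers-Shephard inequality reads \<open>0 \<le> 0\<close>. A convex null set
  lies in a hyperplane, and this hyperplane contains \<open>0\<close>; as both functions are positive at \<open>0\<close>, it
  contains their supports and hence the support of \<open>A \<star> B\<close>.\<close>
lemma null_support_sup_conv:
  fixes A B :: "'a::euclidean_space \<Rightarrow> ennreal"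
  assumes A: "fsigma_superlevels A" "convex {x. 0 < A x}" "0 < A 0"
    and B: "fsigma_superlevels B" "convex {x. 0 < B x}" "0 < B 0"
    and zero: "(\<integral>\<^sup>+x. (sup_conv A (reflect B) x)\<^sup>2 \<partial>lborel) = 0"
  shows "(\<integral>\<^sup>+x. (sup_conv A B x)\<^sup>2 \<partial>lborel) = 0"
proof -
  let ?h = "sup_conv A (reflect B)" and ?w = "sup_conv A B"
  let ?S = "{x. 0 < ?h x}"
  have [measurable]: "?h \<in> borel_measurable borel" "?w \<in> borel_measurable borel"
    using A B by (auto intro!: borel_measurable_fsigma_superlevels fsigma_superlevels_sup_conv fsigma_superlevels_reflect)
  have S: "?S = (\<Union>y\<in>{y. 0 < A y}. \<Union>z\<in>{z. 0 < B z}. {y - z})"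
    by (auto simp: sup_conv_pos_iff reflect_def)
       (metis diff_diff_eq2 diff_add_cancel add.commute add_diff_cancel_left' minus_diff_eq)
  have "convex ?S"
    unfolding S by (intro convex_differences A B)
  have "AE x in lborel. (?h x)\<^sup>2 = 0"
    using zero by (subst (asm) nn_integral_0_iff_AE) simp_all
  then have "AE x in lborel. x \<notin> ?S"
    by eventually_elim simp
  moreover have "?S \<in> sets borel"
    by measurable
  ultimately have "?S \<in> null_sets lborel"
    using AE_iff_null_sets[of ?S lborel] by simp
  then have "negligible ?S"
    using null_sets_completionI by (simp add: negligible_iff_null_sets)
  then have "interior ?S = {}"
    using negligible_convex_interior[OF \<open>convex ?S\<close>] by simp
  then obtain a b where ab: "a \<noteq> 0" "?S \<subseteq> {x. a \<bullet> x = b}"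
    using empty_interior_subset_hyperplane[OF \<open>convex ?S\<close>] by metis
  have on_hyperplane: "a \<bullet> (y - z) = b" if "0 < A y" "0 < B z" for y z
    using ab(2) that unfolding S by blast
  have "b = 0"
    using on_hyperplane[of 0 0] A B by simp
  have "?w x = 0" if "a \<bullet> x \<noteq> 0" for x
  proof (rule ccontr)
    assume "?w x \<noteq> 0"
    then have "0 < ?w x" by (simp add: zero_less_iff_neq_zero)
    then obtain y where "0 < A y" "0 < B (x - y)"
      unfolding sup_conv_pos_iff by auto
    then have "a \<bullet> y = 0" "a \<bullet> (x - y) = 0"
      using on_hyperplane[of y 0] on_hyperplane[of 0 "x - y"] A B \<open>b = 0\<close> by (auto simp: inner_diff_right)
    then have "a \<bullet> x = 0" by (simp add: inner_diff_right)
    with that show False by simp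
  qed
  moreover have "AE x in lborel. a \<bullet> x \<noteq> 0"
  proof -
    have H: "{x. a \<bullet> x = 0} \<in> sets borel"
      by (intro borel_closed closed_hyperplane)
    have "negligible {x. a \<bullet> x = 0}"
      using ab(1) by (intro negligible_hyperplane) simp
    then have "{x. a \<bullet> x = 0} \<in> null_sets lborel"
      using H by (simp add: negligible_iff_null_sets null_sets_completion_iff)
    from AE_not_in[OF this] show ?thesis by simp
  qed
  ultimately have "AE x in lborel. (?w x)\<^sup>2 = 0"
    by (auto elim: eventually_mono)
  then show ?thesis
    by (subst nn_integral_0_iff_AE) auto
qed

text \<open>  With \<open>h = A \<star> reflect B\<close> and \<open>E\<close> its difference function, the two estimates above read
  \<open>2 ^ n * \<integral> (A \<star> B)\<^sup>2 \<le> \<integral> E\<close> and \<open>\<integral> E * \<integral> h\<^sup>2 \<le> 4 ^ n * (\<integral> h\<^sup>2)\<^sup>2\<close>. Squares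
  occur because \<open>E\<close> would otherwise have to be a supremum of square roots.\<close>
theorem nn_integral_sup_conv_le_reflect:
  fixes A B :: "'a::euclidean_space \<Rightarrow> ennreal"
  assumes A: "fsigma_superlevels A" "midpoint_log_concave A" "convex {x. 0 < A x}" "0 < A 0"
    and B: "fsigma_superlevels B" "midpoint_log_concave B" "convex {x. 0 < B x}" "0 < B 0"
  shows "(\<integral>\<^sup>+x. (sup_conv A B x)\<^sup>2 \<partial>lborel)
    \<le> 2 ^ DIM('a) * (\<integral>\<^sup>+x. (sup_conv A (reflect B) x)\<^sup>2 \<partial>lborel)"
proof -
  define h where "h = sup_conv A (reflect B)"
  let ?W = "\<integral>\<^sup>+x. (sup_conv A B x)\<^sup>2 \<partial>lborel" and ?H = "\<integral>\<^sup>+x. (h x)\<^sup>2 \<partial>lborel"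
    and ?E = "\<integral>\<^sup>+x. sup_conv h (reflect h) x \<partial>lborel"
  have h: "fsigma_superlevels h" "midpoint_log_concave h"
    using A B unfolding h_def
    by (auto intro!: fsigma_superlevels_sup_conv fsigma_superlevels_reflect
        midpoint_log_concave_sup_conv midpoint_log_concave_reflect)
  have lower: "2 ^ DIM('a) * ?W \<le> ?E"
    using A B h sup_conv_self_mult_le[of A B]
    by (intro nn_integral_difference_function_ge borel_measurable_fsigma_superlevels fsigma_superlevels_sup_conv
        fsigma_superlevels_reflect) (auto simp: h_def)
  have upper: "?E * ?H \<le> 4 ^ DIM('a) * ?H\<^sup>2"
    using h by (intro nn_integral_difference_function_le)
  \<comment> \<open>Division by \<open>?H\<close> needs it to be positive and finite.\<close>
  consider "?H = 0" | "?H = top" | "?H \<noteq> 0" "?H \<noteq> top" by blast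
  then show ?thesis
  proof cases
    case 1
    then show ?thesis
      using null_support_sup_conv[OF A(1,3,4) B(1,3,4)] by (simp add: h_def)
  next
    case 2
    then show ?thesis by (simp add: h_def ennreal_mult_top)
  next
    case 3
    have "?H * ?E \<le> ?H * (4 ^ DIM('a) * ?H)"
      using upper by (simp add: power2_eq_square ac_simps)
    then have "?E \<le> 4 ^ DIM('a) * ?H"
      using 3 by (simp add: ennreal_mult_le_mult_iff)
    then have "2 ^ DIM('a) * ?W \<le> 2 ^ DIM('a) * (2 ^ DIM('a) * ?H)"
      using lower by (simp add: mult.assoc[symmetric] power_mult_distrib[symmetric] order.trans)
    then show ?thesis
      by (subst (asm) ennreal_mult_le_mult_iff) (simp_all add: h_def power_eq_top_ennreal)
  qed
qed


section \<open>The sum of log-concave functions\<close>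

lemma alpha_sum_term_bounds:
  assumes "\<alpha> \<le> 0" "0 \<le> a" "a \<le> 1" "0 \<le> b" "b \<le> 1"
  shows "0 \<le> alpha_sum_term \<alpha> a b" "alpha_sum_term \<alpha> a b \<le> 1"
proof -
  show "0 \<le> alpha_sum_term \<alpha> a b"
    using assms by (simp add: alpha_sum_term_def)
  show "alpha_sum_term \<alpha> a b \<le> 1"
  proof (cases "\<alpha> = 0 \<or> a = 0 \<or> b = 0")
    case True
    then show ?thesis using assms by (auto simp: alpha_sum_term_def mult_le_one)
  next
    case False
    have ge: "1 \<le> u powr \<alpha>" if "0 < u" "u \<le> 1" for u
      using powr_mono2'[of \<alpha> u 1] assms that by simp
    have "1 \<le> a powr \<alpha> + b powr \<alpha> - 1"
      using ge[of a] ge[of b] False assms by simp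
    then have "(a powr \<alpha> + b powr \<alpha> - 1) powr (1 / \<alpha>) \<le> 1 powr (1 / \<alpha>)"
      using assms by (intro powr_mono2') auto
    with False show ?thesis by (simp add: alpha_sum_term_def)
  qed
qed

context
  fixes \<alpha> :: real and f g :: "'a::ab_group_add \<Rightarrow> real"
  assumes \<alpha>: "\<alpha> \<le> 0" and f: "\<And>x. 0 \<le> f x" "\<And>x. f x \<le> 1" and g: "\<And>x. 0 \<le> g x" "\<And>x. g x \<le> 1"
begin

lemma alpha_sum_upper: "alpha_sum_term \<alpha> (f y) (g z) \<le> alpha_sum \<alpha> f g (y + z)"
proof -
  have "alpha_sum_term \<alpha> (f (fst p)) (g (snd p)) \<le> 1" for p
    by (rule alpha_sum_term_bounds(2)[OF \<alpha> f g])
  then show ?thesis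
    unfolding alpha_sum_def
    by (intro cSUP_upper2[where x = "(y, z)"] bdd_aboveI[of _ 1]) (auto simp: case_prod_beta)
qed

lemma alpha_sum_least:
  assumes "\<And>y z. y + z = x \<Longrightarrow> alpha_sum_term \<alpha> (f y) (g z) \<le> c"
  shows "alpha_sum \<alpha> f g x \<le> c"
proof -
  have "(0, x) \<in> {(y, z). y + z = x}" by simp
  then have "{(y, z). y + z = x} \<noteq> {}" by blast
  then show ?thesis
    unfolding alpha_sum_def using assms by (intro cSUP_least) auto
qed

lemma alpha_sum_bounds: "0 \<le> alpha_sum \<alpha> f g x" "alpha_sum \<alpha> f g x \<le> 1"
proof -
  show "0 \<le> alpha_sum \<alpha> f g x"
    using order.trans[OF alpha_sum_term_bounds(1)[OF \<alpha> f g] alpha_sum_upper[of 0 x]] by simp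
  show "alpha_sum \<alpha> f g x \<le> 1"
    by (rule alpha_sum_least) (rule alpha_sum_term_bounds(2)[OF \<alpha> f g])
qed

end

text \<open>  Powers commute with suprema of products, so the powers of one real sup-convolution describe the
  sup-convolutions of all powers. In this form they are jointly measurable in
  \<open>x\<close> and \<open>p\<close>, as soon as the \<open>0\<close>-sum of \<open>F\<close> and \<open>G\<close> is measurable.\<close>
lemma alpha_sum_0_powr:
  fixes F G :: "'a::ab_group_add \<Rightarrow> real"
  assumes F: "\<And>x. 0 \<le> F x" "\<And>x. F x \<le> 1" and G: "\<And>x. 0 \<le> G x" "\<And>x. G x \<le> 1" and p: "0 < p"
  shows "ennreal (alpha_sum 0 F G x powr p) = sup_conv (\<lambda>x. ennreal (F x powr p)) (\<lambda>x. ennreal (G x powr p)) x"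
    (is "ennreal (?W powr p) = ?S")
proof (rule antisym)
  have W: "0 \<le> ?W"
    using F G by (intro alpha_sum_bounds) auto
  show "?S \<le> ennreal (?W powr p)"
    unfolding sup_conv_def
  proof (rule SUP_least)
    fix y
    have "F y * G (x - y) \<le> ?W"
      using alpha_sum_upper[of 0 F G y "x - y"] F G by (simp add: alpha_sum_term_def)
    then have "(F y * G (x - y)) powr p \<le> ?W powr p"
      using F G p by (intro powr_mono2) auto
    then show "ennreal (F y powr p) * ennreal (G (x - y) powr p) \<le> ennreal (?W powr p)"
      using F G by (simp add: powr_mult ennreal_mult[symmetric] ennreal_leI)
  qed
  then obtain r where r: "?S = ennreal r" "0 \<le> r"
    by (cases ?S) (auto simp: top_unique)
  have "?W \<le> r powr (1 / p)"
  proof (rule alpha_sum_least)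
    fix y z assume "y + z = x"
    then have "ennreal (F y powr p) * ennreal (G z powr p) \<le> ?S"
      unfolding sup_conv_def by (intro SUP_upper2[of y]) auto
    then have "(F y * G z) powr p \<le> r"
      using F G r by (simp add: powr_mult ennreal_mult[symmetric])
    then have "((F y * G z) powr p) powr (1 / p) \<le> r powr (1 / p)"
      using p by (intro powr_mono2) auto
    then show "alpha_sum_term 0 (F y) (G z) \<le> r powr (1 / p)"
      using F G p by (simp add: alpha_sum_term_def powr_powr)
  qed (use F G in auto)
  then have "?W powr p \<le> (r powr (1 / p)) powr p"
    using W p by (intro powr_mono2) auto
  then show "ennreal (?W powr p) \<le> ?S"
    using p r by (simp add: powr_powr ennreal_leI)
qed

definition log_concave_peak :: "(real ^ 'n \<Rightarrow> real) \<Rightarrow> bool" where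
  "log_concave_peak F \<longleftrightarrow> (\<forall>x. 0 \<le> F x \<and> F x \<le> 1) \<and> F 0 = 1 \<and> alpha_concave 0 F \<and> (\<forall>s. fsigma {x. s < F x})"

lemma log_concave_peak_powr:
  fixes F :: "real ^ 'n \<Rightarrow> real"
  assumes F: "log_concave_peak F" and p: "0 < p"
  defines "A \<equiv> \<lambda>x. ennreal (F x powr p)"
  shows "fsigma_superlevels A" "midpoint_log_concave A" "convex {x. 0 < A x}" "0 < A 0"
proof -
  have nonneg: "0 \<le> F x" for x
    using F by (simp add: log_concave_peak_def)
  have conc: "F (t *\<^sub>R x + (1 - t) *\<^sub>R y) \<ge> F x powr t * F y powr (1 - t)"
    if "0 < F x" "0 < F y" "0 \<le> t" "t \<le> 1" for x y t
    using F that by (auto simp: log_concave_peak_def alpha_concave_def alpha_mean_def)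
  show "fsigma_superlevels A"
    unfolding fsigma_superlevels_def
  proof
    fix s :: ennreal
    show "fsigma {x. s < A x}"
    proof (cases s)
      case (real r)
      have "s < A x \<longleftrightarrow> r powr (1 / p) < F x" for x
      proof -
        have "r < F x powr p \<longleftrightarrow> r powr (1 / p) < F x"
          using p real nonneg[of x] powr_less_cancel_iff powr_less_mono2[of "1 / p" r "F x powr p"]
            powr_less_mono2[of p "r powr (1 / p)" "F x"]
          by (auto simp: powr_powr)
        then show ?thesis
          using real nonneg[of x] by (simp add: A_def ennreal_less_iff)
      qed
      then show ?thesis
        using F by (simp add: log_concave_peak_def)
    next
      case top
      then show ?thesis by (simp add: closed_imp_fsigma)
    qed
  qed
  have pos: "0 < A x \<longleftrightarrow> 0 < F x" for x
    using nonneg[of x] by (auto simp: A_def)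
  show "midpoint_log_concave A"
    unfolding midpoint_log_concave_def
  proof (intro allI)
    fix x y
    show "A x * A y \<le> (A (midpoint x y))\<^sup>2"
    proof (cases "0 < F x \<and> 0 < F y")
      case True
      have "F x powr (1/2) * F y powr (1/2) \<le> F (midpoint x y)"
        using conc[of x y "1/2"] True by (simp add: midpoint_def scaleR_add_right)
      then have "(F x powr (1/2) * F y powr (1/2)) powr (2 * p) \<le> F (midpoint x y) powr (2 * p)"
        using p by (intro powr_mono2) auto
      then have "F x powr p * F y powr p \<le> F (midpoint x y) powr (2 * p)"
        using True p by (simp add: powr_mult powr_powr)
      also have "\<dots> = (F (midpoint x y) powr p)\<^sup>2"
        by (simp add: power2_eq_square flip: powr_add)
      finally show ?thesis
        by (simp add: A_def ennreal_power ennreal_mult[symmetric] ennreal_leI)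
    next
      case False
      then have "A x = 0 \<or> A y = 0"
        using nonneg[of x] nonneg[of y] by (auto simp: A_def)
      then show ?thesis by auto
    qed
  qed
  show "convex {x. 0 < A x}"
    unfolding pos convex_alt
  proof (intro ballI allI impI, unfold mem_Collect_eq)
    fix x y u assume "0 < F x" "0 < F y" "0 \<le> u \<and> u \<le> (1::real)"
    then have "0 < F x powr (1 - u) * F y powr u" "F x powr (1 - u) * F y powr u \<le> F ((1 - u) *\<^sub>R x + u *\<^sub>R y)"
      using conc[of x y "1 - u"] by auto
    then show "0 < F ((1 - u) *\<^sub>R x + u *\<^sub>R y)"
      by linarith
  qed
  show "0 < A 0"
    using F by (simp add: A_def log_concave_peak_def)
qed

text \<open>  The square in the inequality for sup-convolutions is absorbed by starting from the powers
  \<open>F powr (p / 2)\<close> and \<open>G powr (p / 2)\<close>.\<close>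
lemma nn_integral_alpha_sum_0_powr_le_reflection:
  fixes F G :: "real ^ 'n \<Rightarrow> real"
  assumes F: "log_concave_peak F" and G: "log_concave_peak G" and p: "0 < p"
  shows "(\<integral>\<^sup>+x. ennreal (alpha_sum 0 F G x powr p) \<partial>lborel)
    \<le> 2 ^ CARD('n) * (\<integral>\<^sup>+x. ennreal (alpha_sum 0 F (reflection G) x powr p) \<partial>lborel)"
proof -
  have bounds: "0 \<le> F x" "F x \<le> 1" "0 \<le> G x" "G x \<le> 1" for x
    using F G by (auto simp: log_concave_peak_def)
  let ?A = "\<lambda>x. ennreal (F x powr (p / 2))" and ?B = "\<lambda>x. ennreal (G x powr (p / 2))"
  have split: "ennreal (u powr p) = (ennreal (u powr (p / 2)))\<^sup>2" for u
  proof -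
    have "u powr p = (u powr (p / 2))\<^sup>2"
      by (simp add: power2_eq_square flip: powr_add)
    then show ?thesis by (simp add: ennreal_power)
  qed
  have sum: "ennreal (alpha_sum 0 F G x powr p) = (sup_conv ?A ?B x)\<^sup>2" for x
    unfolding split using p bounds by (subst alpha_sum_0_powr) auto
  have "ennreal (alpha_sum 0 F (reflection G) x powr p) = (sup_conv ?A (\<lambda>x. ennreal (reflection G x powr (p / 2))) x)\<^sup>2" for x
    unfolding split using p bounds by (subst alpha_sum_0_powr) (auto simp: reflection_def)
  also have "(\<lambda>x. ennreal (reflection G x powr (p / 2))) = reflect ?B"
    by (simp add: reflect_def reflection_def fun_eq_iff)
  finally have diff: "ennreal (alpha_sum 0 F (reflection G) x powr p) = (sup_conv ?A (reflect ?B) x)\<^sup>2" for x .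
  have "0 < p / 2" using p by simp
  then show ?thesis
    unfolding sum diff
    using nn_integral_sup_conv_le_reflect[OF log_concave_peak_powr[OF F] log_concave_peak_powr[OF G]] by simp
qed

lemma borel_measurable_alpha_sum_0:
  fixes F G :: "real ^ 'n \<Rightarrow> real"
  assumes F: "\<And>x. 0 \<le> F x" "\<And>x. F x \<le> 1" "\<And>s. fsigma {x. s < F x}"
    and G: "\<And>x. 0 \<le> G x" "\<And>x. G x \<le> 1" "\<And>s. fsigma {x. s < G x}"
  shows "alpha_sum 0 F G \<in> borel_measurable borel"
proof -
  have superlevels: "fsigma_superlevels (\<lambda>x. ennreal (u x))"
    if "\<And>s. fsigma {x. s < u x}" "\<And>x. 0 \<le> u x" for u :: "real ^ 'n \<Rightarrow> real"
    unfolding fsigma_superlevels_def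
  proof
    fix s :: ennreal
    show "fsigma {x. s < ennreal (u x)}"
      using that by (cases s) (auto simp: ennreal_less_iff closed_imp_fsigma)
  qed
  have "alpha_sum 0 F G x = enn2real (sup_conv (\<lambda>x. ennreal (F x)) (\<lambda>x. ennreal (G x)) x)" for x
  proof -
    have "0 \<le> alpha_sum 0 F G x"
      using F G by (intro alpha_sum_bounds) auto
    then have "ennreal (alpha_sum 0 F G x) = sup_conv (\<lambda>x. ennreal (F x)) (\<lambda>x. ennreal (G x)) x"
      using alpha_sum_0_powr[of F G 1 x] F G by simp
    with \<open>0 \<le> alpha_sum 0 F G x\<close> show ?thesis
      by (metis enn2real_ennreal)
  qed
  moreover have "sup_conv (\<lambda>x. ennreal (F x)) (\<lambda>x. ennreal (G x)) \<in> borel_measurable borel"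
    using F G by (intro borel_measurable_fsigma_superlevels fsigma_superlevels_sup_conv superlevels)
  ultimately show ?thesis
    by (simp cong: measurable_cong)
qed


section \<open>From \<open>\<alpha>\<close>-concave to log-concave functions\<close>

lemma closed_superlevel:
  assumes "upper_semicontinuous f"
  shows "closed {x. c \<le> f x}"
proof -
  have "open {x. f x < c}"
  proof (subst open_subopen, intro ballI)
    fix x assume "x \<in> {x. f x < c}"
    then have "eventually (\<lambda>y. f y < c) (nhds x)"
      using assms by (simp add: upper_semicontinuous_def)
    then obtain S where "open S" "x \<in> S" "\<forall>y\<in>S. f y < c"
      unfolding eventually_nhds by auto
    then show "\<exists>T. open T \<and> x \<in> T \<and> T \<subseteq> {x. f x < c}"
      by auto
  qed
  moreover have "{x. c \<le> f x} = - {x. f x < c}"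
    by auto
  ultimately show ?thesis
    by (simp add: closed_Compl)
qed

lemma fsigma_superlevel:
  assumes "upper_semicontinuous f"
  shows "fsigma {x. c < f x}"
proof -
  define e where "e n = inverse (real (Suc n))" for n
  have e: "0 < e n" for n
    by (simp add: e_def)
  have "\<exists>n. c + e n \<le> f x" if less: "c < f x" for x
  proof -
    obtain n where "e n < f x - c"
      using reals_Archimedean[of "f x - c"] less unfolding e_def by auto
    then have "c + e n \<le> f x" by simp
    then show ?thesis ..
  qed
  moreover have "c < f x" if "c + e n \<le> f x" for x n
    using e[of n] that by simp
  ultimately have "{x. c < f x} = (\<Union>n. {x. c + e n \<le> f x})"
    by blast
  also have "fsigma \<dots>"
    by (rule fsigma.intros) (rule closed_superlevel[OF assms])
  finally show ?thesis .
qed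

lemma C_alpha_bounds:
  assumes "f \<in> C_alpha \<alpha>"
  shows "0 \<le> f x" "f x \<le> 1"
proof -
  show "0 \<le> f x" using assms by (simp add: C_alpha_def)
  have "f x \<le> (SUP x. f x)"
    using assms by (intro cSUP_upper) (auto simp: C_alpha_def)
  then show "f x \<le> 1" using assms by (simp add: C_alpha_def)
qed

text \<open>  For negative \<open>\<alpha>\<close>, \<open>log_scale \<alpha>\<close> and \<open>alpha_scale \<alpha>\<close> are inverse monotone bijections of
  the unit interval. The first one turns \<open>\<alpha>\<close>-concave functions into log-concave ones and the
  \<open>\<alpha>\<close>-sum into the \<open>0\<close>-sum. The value at \<open>0\<close> is the limit value; \<open>0 powr \<alpha> = 0\<close> and \<open>ln 0 = 0\<close>
  would give a wrong one.\<close>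
definition log_scale :: "real \<Rightarrow> real \<Rightarrow> real" where
  "log_scale \<alpha> a = (if a = 0 then 0 else exp (1 - a powr \<alpha>))"

definition alpha_scale :: "real \<Rightarrow> real \<Rightarrow> real" where
  "alpha_scale \<alpha> a = (if a = 0 then 0 else (1 - ln a) powr (1 / \<alpha>))"

context
  fixes \<alpha> :: real
  assumes neg: "\<alpha> < 0"
begin

lemma powr_neg_ge_1: "0 < u \<Longrightarrow> u \<le> 1 \<Longrightarrow> 1 \<le> u powr \<alpha>"
  using powr_mono2'[of \<alpha> u 1] neg by simp

lemma log_scale_bounds: "0 \<le> a \<Longrightarrow> a \<le> 1 \<Longrightarrow> 0 \<le> log_scale \<alpha> a \<and> log_scale \<alpha> a \<le> 1"
  using powr_neg_ge_1[of a] by (auto simp: log_scale_def)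

lemma alpha_scale_log_scale: "0 \<le> a \<Longrightarrow> alpha_scale \<alpha> (log_scale \<alpha> a) = a"
  using neg by (auto simp: alpha_scale_def log_scale_def powr_powr)

lemma log_scale_alpha_scale: "0 \<le> a \<Longrightarrow> a \<le> 1 \<Longrightarrow> log_scale \<alpha> (alpha_scale \<alpha> a) = a"
proof (cases "a = 0")
  case False
  assume "0 \<le> a" "a \<le> 1"
  then have "0 < a" "0 < 1 - ln a"
    using False ln_le_minus_one[of a] by auto
  then show ?thesis
    using neg by (auto simp: alpha_scale_def log_scale_def powr_powr)
qed (simp add: alpha_scale_def log_scale_def)

lemma log_scale_mono: "0 \<le> a \<Longrightarrow> a \<le> b \<Longrightarrow> log_scale \<alpha> a \<le> log_scale \<alpha> b"
  using powr_mono2'[of \<alpha> a b] neg by (auto simp: log_scale_def)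

lemma alpha_scale_mono: "0 \<le> a \<Longrightarrow> a \<le> b \<Longrightarrow> b \<le> 1 \<Longrightarrow> alpha_scale \<alpha> a \<le> alpha_scale \<alpha> b"
proof (cases "a = 0")
  case False
  assume *: "0 \<le> a" "a \<le> b" "b \<le> 1"
  then have "0 < a" "0 < b" using False by auto
  then have "0 < 1 - ln b" "1 - ln b \<le> 1 - ln a"
    using * ln_le_minus_one[of b] by auto
  then show ?thesis
    using powr_mono2'[of "1 / \<alpha>" "1 - ln b" "1 - ln a"] neg False * by (auto simp: alpha_scale_def)
qed (simp add: alpha_scale_def)

lemma alpha_sum_term_eq_alpha_scale:
  assumes "0 \<le> a" "a \<le> 1" "0 \<le> b" "b \<le> 1"
  shows "alpha_sum_term \<alpha> a b = alpha_scale \<alpha> (log_scale \<alpha> a * log_scale \<alpha> b)"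
proof (cases "a = 0 \<or> b = 0")
  case False
  have "a powr \<alpha> + b powr \<alpha> - 1 = 1 - ln (exp (1 - a powr \<alpha>) * exp (1 - b powr \<alpha>))"
    by (simp flip: exp_add)
  with False show ?thesis
    using neg by (simp add: alpha_sum_term_def alpha_scale_def log_scale_def)
qed (use neg in \<open>auto simp: alpha_sum_term_def alpha_scale_def log_scale_def\<close>)

lemma alpha_sum_eq_alpha_scale:
  fixes f g :: "'a::ab_group_add \<Rightarrow> real"
  assumes f: "\<And>x. 0 \<le> f x" "\<And>x. f x \<le> 1" and g: "\<And>x. 0 \<le> g x" "\<And>x. g x \<le> 1"
  shows "alpha_sum \<alpha> f g x = alpha_scale \<alpha> (alpha_sum 0 (\<lambda>x. log_scale \<alpha> (f x)) (\<lambda>x. log_scale \<alpha> (g x)) x)"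
proof -
  define F where "F x = log_scale \<alpha> (f x)" for x
  define G where "G x = log_scale \<alpha> (g x)" for x
  have F: "\<And>x. 0 \<le> F x" "\<And>x. F x \<le> 1" and G: "\<And>x. 0 \<le> G x" "\<And>x. G x \<le> 1"
    using log_scale_bounds f g by (auto simp: F_def G_def)
  let ?S = "alpha_sum \<alpha> f g x" and ?W = "alpha_sum 0 F G x"
  have term_eq: "alpha_sum_term \<alpha> (f y) (g z) = alpha_scale \<alpha> (F y * G z)" for y z
    unfolding F_def G_def by (rule alpha_sum_term_eq_alpha_scale[OF f g])
  have W: "0 \<le> ?W" "?W \<le> 1"
    using alpha_sum_bounds[of 0 F G x] F G by auto
  have S: "0 \<le> ?S" "?S \<le> 1"
    using alpha_sum_bounds[of \<alpha> f g x] neg f g by auto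
  have "?S \<le> alpha_scale \<alpha> ?W"
  proof (rule alpha_sum_least[OF less_imp_le[OF neg] f g])
    fix y z assume "y + z = x"
    then have "F y * G z \<le> ?W"
      using alpha_sum_upper[of 0 F G y z] F G by (simp add: alpha_sum_term_def)
    then show "alpha_sum_term \<alpha> (f y) (g z) \<le> alpha_scale \<alpha> ?W"
      unfolding term_eq using F G W by (intro alpha_scale_mono) auto
  qed
  moreover have "?W \<le> log_scale \<alpha> ?S"
  proof (rule alpha_sum_least[OF order.refl F G])
    fix y z assume "y + z = x"
    then have "alpha_sum_term \<alpha> (f y) (g z) \<le> ?S"
      using alpha_sum_upper[of \<alpha> f g y z] neg f g by simp
    then have "log_scale \<alpha> (alpha_sum_term \<alpha> (f y) (g z)) \<le> log_scale \<alpha> ?S"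
      using alpha_sum_term_bounds(1)[OF less_imp_le[OF neg] f g] by (intro log_scale_mono) auto
    moreover have "log_scale \<alpha> (alpha_sum_term \<alpha> (f y) (g z)) = F y * G z"
      unfolding term_eq using F G by (intro log_scale_alpha_scale) (auto intro: mult_le_one)
    ultimately show "alpha_sum_term 0 (F y) (G z) \<le> log_scale \<alpha> ?S"
      by (simp add: alpha_sum_term_def)
  qed
  then have "alpha_scale \<alpha> ?W \<le> alpha_scale \<alpha> (log_scale \<alpha> ?S)"
    using W log_scale_bounds[OF S] by (intro alpha_scale_mono) auto
  ultimately show ?thesis
    using S by (simp add: alpha_scale_log_scale F_def[abs_def] G_def[abs_def])
qed

text \<open>  The function \<open>log_scale \<alpha> (f x)\<close> is the exponential of \<open>1 - f x powr \<alpha>\<close>, and for negative \<open>\<alpha>\<close>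
  the \<open>\<alpha>\<close>-concavity of \<open>f\<close> says that \<open>f powr \<alpha>\<close> is convex on the support of \<open>f\<close>.\<close>
lemma log_scale_log_concave_peak:
  assumes f: "f \<in> C_alpha \<alpha>"
  shows "log_concave_peak (\<lambda>x. log_scale \<alpha> (f x))"
  unfolding log_concave_peak_def
proof (intro conjI allI)
  note bounds = C_alpha_bounds[OF f]
  show "0 \<le> log_scale \<alpha> (f x)" "log_scale \<alpha> (f x) \<le> 1" for x
    using log_scale_bounds bounds by auto
  show "log_scale \<alpha> (f 0) = 1"
    using f by (simp add: C_alpha_def log_scale_def)
  show "alpha_concave 0 (\<lambda>x. log_scale \<alpha> (f x))"
    unfolding alpha_concave_def
  proof (intro allI impI ballI)
    fix x y and t :: real
    assume pos: "0 < log_scale \<alpha> (f x)" "0 < log_scale \<alpha> (f y)" and t: "t \<in> {0..1}"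
    let ?z = "t *\<^sub>R x + (1 - t) *\<^sub>R y"
    let ?m = "t * f x powr \<alpha> + (1 - t) * f y powr \<alpha>"
    have fpos: "0 < f x" "0 < f y"
      using pos bounds[of x] bounds[of y] by (auto simp: log_scale_def split: if_splits)
    then have "?m powr (1 / \<alpha>) \<le> f ?z"
      using f t neg by (auto simp: C_alpha_def alpha_concave_def alpha_mean_def)
    moreover have m: "0 < ?m"
    proof (cases "t = 0")
      case False
      then have "0 < t * f x powr \<alpha>" "0 \<le> (1 - t) * f y powr \<alpha>"
        using t fpos by auto
      then show ?thesis by linarith
    qed (use fpos in simp)
    ultimately have "log_scale \<alpha> (?m powr (1 / \<alpha>)) \<le> log_scale \<alpha> (f ?z)"
      by (intro log_scale_mono) auto
    moreover have "log_scale \<alpha> (?m powr (1 / \<alpha>)) = exp (1 - ?m)"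
      using m neg by (simp add: log_scale_def powr_powr)
    moreover have "exp (1 - ?m) = alpha_mean 0 t (log_scale \<alpha> (f x)) (log_scale \<alpha> (f y))"
      using fpos by (simp add: alpha_mean_def log_scale_def powr_def flip: exp_add) (simp add: algebra_simps)
    ultimately show "alpha_mean 0 t (log_scale \<alpha> (f x)) (log_scale \<alpha> (f y)) \<le> log_scale \<alpha> (f ?z)"
      by simp
  qed
  show "fsigma {x. s < log_scale \<alpha> (f x)}" for s
  proof -
    consider "s < 0" | "0 \<le> s" "s \<le> 1" | "1 < s" by linarith
    then show ?thesis
    proof cases
      case 1
      then have "s < log_scale \<alpha> (f x)" for x
        using log_scale_bounds[OF bounds, of x] by simp
      then have "{x. s < log_scale \<alpha> (f x)} = UNIV"
        by blast
      then show ?thesis by simp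
    next
      case 2
      have "s < log_scale \<alpha> (f x) \<longleftrightarrow> alpha_scale \<alpha> s < f x" for x
      proof
        assume "s < log_scale \<alpha> (f x)"
        then show "alpha_scale \<alpha> s < f x"
          using log_scale_mono[of "f x" "alpha_scale \<alpha> s"] log_scale_alpha_scale[OF 2] bounds[of x]
          by linarith
      next
        assume "alpha_scale \<alpha> s < f x"
        then show "s < log_scale \<alpha> (f x)"
          using alpha_scale_mono[of "log_scale \<alpha> (f x)" s] alpha_scale_log_scale[of "f x"]
            bounds[of x] log_scale_bounds[of "f x"] 2
          by linarith
      qed
      then show ?thesis
        using f by (auto simp: C_alpha_def intro: fsigma_superlevel)
    next
      case 3
      then have "\<not> s < log_scale \<alpha> (f x)" for x
        using log_scale_bounds[OF bounds, of x] by simp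
      then have "{x. s < log_scale \<alpha> (f x)} = {}"
        by blast
      then show ?thesis by (simp add: closed_imp_fsigma)
    qed
  qed
qed

text \<open>  Euler's integral \<open>\<Gamma> m * c powr (- m) = \<integral> t powr (m - 1) * exp (- c * t) dt\<close> at \<open>m = - 1 / \<alpha>\<close>
  and \<open>c = 1 - ln a\<close>, where \<open>exp (- c * t) = exp (- t) * a powr t\<close>. It writes \<open>alpha_scale \<alpha> a\<close> as
  a mixture of powers of \<open>a\<close> with positive weights that do not depend on \<open>a\<close>.\<close>
lemma alpha_scale_eq_gamma_mixture:
  assumes "0 \<le> a" "a \<le> 1"
  shows "ennreal (Gamma (- (1 / \<alpha>))) * ennreal (alpha_scale \<alpha> a)
    = (\<integral>\<^sup>+t. ennreal (indicator {0..} t * t powr (- (1 / \<alpha>) - 1) / exp t) * ennreal (a powr t) \<partial>lborel)"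
proof (cases "a = 0")
  case True
  then show ?thesis by (simp add: alpha_scale_def)
next
  case False
  define m where "m = - (1 / \<alpha>)"
  define c where "c = 1 - ln a"
  have m: "0 < m" and c: "0 < c"
    using neg False assms ln_le_minus_one[of a] by (auto simp: m_def c_def)
  let ?w = "\<lambda>t::real. indicator {0..} t * t powr (m - 1) / exp t"
  have "(\<integral>\<^sup>+t. ennreal (?w t) * ennreal (a powr t) \<partial>lborel)
      = ennreal \<bar>1 / c\<bar> * (\<integral>\<^sup>+s. ennreal (?w (0 + 1 / c * s)) * ennreal (a powr (0 + 1 / c * s)) \<partial>lborel)"
    using c by (intro nn_integral_real_affine) simp_all
  also have "(\<integral>\<^sup>+s. ennreal (?w (0 + 1 / c * s)) * ennreal (a powr (0 + 1 / c * s)) \<partial>lborel)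
      = (\<integral>\<^sup>+s. ennreal (c powr (1 - m)) * ennreal (?w s) \<partial>lborel)"
  proof (rule nn_integral_cong)
    fix s :: real
    show "ennreal (?w (0 + 1 / c * s)) * ennreal (a powr (0 + 1 / c * s)) = ennreal (c powr (1 - m)) * ennreal (?w s)"
    proof (cases "0 \<le> s")
      case True
      have "a powr (s / c) / exp (s / c) = 1 / exp s"
      proof -
        have "s / c * ln a - s / c = s / c * (ln a - 1)"
          by (simp add: right_diff_distrib)
        also have "ln a - 1 = - c" by (simp add: c_def)
        also have "s / c * (- c) = - s" using c by simp
        finally have "s / c * ln a - s / c = - s" .
        then have "exp (s / c * ln a - s / c) = exp (- s)" by simp
        then show ?thesis
          using False by (simp add: powr_def exp_diff exp_minus field_simps)
      qed
      moreover have "(s / c) powr (m - 1) = c powr (1 - m) * s powr (m - 1)"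
      proof -
        have "c powr (1 - m) = 1 / c powr (m - 1)"
          using powr_minus_divide[of c "m - 1"] by (simp only: minus_diff_eq)
        then show ?thesis
          by (simp only: powr_divide times_divide_eq_left mult_1_left)
      qed
      moreover have "?w (0 + 1 / c * s) * a powr (0 + 1 / c * s)
          = (s / c) powr (m - 1) * (a powr (s / c) / exp (s / c))"
        using True c by simp
      ultimately have "?w (0 + 1 / c * s) * a powr (0 + 1 / c * s) = c powr (1 - m) * ?w s"
        using True by simp
      then show ?thesis
        using True c by (simp add: ennreal_mult[symmetric])
    next
      case False
      then show ?thesis using c by (simp add: zero_le_divide_iff)
    qed
  qed
  also have "\<dots> = ennreal (c powr (1 - m)) * ennreal (Gamma m)"
    by (subst nn_integral_cmult) (simp_all add: Gamma_conv_nn_integral_real[OF m])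
  also have "ennreal \<bar>1 / c\<bar> * (ennreal (c powr (1 - m)) * ennreal (Gamma m)) = ennreal (Gamma m) * ennreal (c powr (- m))"
  proof -
    have "\<bar>1 / c\<bar> * c powr (1 - m) = c powr (- m)"
    proof -
      have "\<bar>1 / c\<bar> = c powr (- 1)"
        using c powr_minus_divide[of c 1] by simp
      moreover have "c powr (- 1) * c powr (1 - m) = c powr (- m)"
        by (simp only: powr_add[symmetric]) simp
      ultimately show ?thesis by simp
    qed
    moreover have "ennreal (\<bar>1 / c\<bar> * c powr (1 - m)) = ennreal \<bar>1 / c\<bar> * ennreal (c powr (1 - m))"
      by (rule ennreal_mult) simp_all
    ultimately show ?thesis
      by (simp only: mult.assoc mult.commute mult.left_commute)
  qed
  finally show ?thesis
    using False by (simp add: alpha_scale_def m_def c_def)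
qed

end

section \<open>The constants\<close>

lemma four_power_le_central_binomial: "4 ^ n \<le> (n + 1) * ((2 * n) choose n)"
proof (induction n)
  case (Suc n)
  have step: "(n + 1) * ((2 * Suc n) choose Suc n) = 2 * (2 * n + 1) * ((2 * n) choose n)"
  proof -
    have "(n + 1) * ((2 * Suc n) choose Suc n) = 2 * ((n + 1) * (Suc (2 * n) choose n))"
      using Suc_times_binomial_eq[of "Suc (2 * n)" n] by (simp add: algebra_simps)
    also have "Suc (2 * n) choose n = Suc (2 * n) choose Suc n"
      using binomial_symmetric[of n "Suc (2 * n)"] by (simp add: Suc_diff_le)
    also have "(n + 1) * (Suc (2 * n) choose Suc n) = (2 * n + 1) * ((2 * n) choose n)"
      using Suc_times_binomial_eq[of "2 * n" n] by (simp add: algebra_simps)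
    finally show ?thesis by simp
  qed
  have "(n + 1) * 4 ^ Suc n \<le> 4 * (n + 1) * ((n + 1) * ((2 * n) choose n))"
    using mult_le_mono2[OF Suc.IH, of "4 * (n + 1)"] by (simp add: algebra_simps)
  also have "\<dots> \<le> (n + 2) * (2 * (2 * n + 1) * ((2 * n) choose n))"
    by (simp add: algebra_simps)
  also have "\<dots> = (n + 1) * ((Suc n + 1) * ((2 * Suc n) choose Suc n))"
    unfolding step[symmetric] by (simp only: mult.left_commute[of "n + 2"] Suc_eq_plus1 add.assoc one_add_one)
  finally have "(n + 1) * 4 ^ Suc n \<le> (n + 1) * ((Suc n + 1) * ((2 * Suc n) choose Suc n))" .
  then show ?case
    by (simp only: mult_le_cancel1)
qed simp


text \<open>  For negative \<open>\<alpha>\<close> the \<open>\<alpha>\<close>-sums are \<open>alpha_scale \<alpha> (W x)\<close> for \<open>0\<close>-sums \<open>W\<close>, hence mixtures of the powers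
  \<open>W x powr t\<close>. The inequality holds for every power with the same constant \<open>2 ^ n\<close>, so it can be
  integrated against the weights.\<close>
lemma L1_norm_alpha_sum_le_reflection:
  fixes f g :: "real ^ 'n \<Rightarrow> real"
  assumes "\<alpha> \<le> 0" and f: "f \<in> C_alpha \<alpha>" and g: "g \<in> C_alpha \<alpha>"
  shows "L1_norm (alpha_sum \<alpha> f g) \<le> 2 ^ CARD('n) * L1_norm (alpha_sum \<alpha> f (reflection g))"
proof (cases "\<alpha> = 0")
  case True
  have peak: "log_concave_peak u" if "u \<in> C_alpha \<alpha>" for u :: "real ^ 'n \<Rightarrow> real"
    using C_alpha_bounds[OF that] that True
    by (auto simp: log_concave_peak_def C_alpha_def intro: fsigma_superlevel)
  have "0 \<le> alpha_sum 0 f u x" if "\<And>x. 0 \<le> u x" "\<And>x. u x \<le> 1" for u x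
    using C_alpha_bounds[OF f] that by (intro alpha_sum_bounds) auto
  then have "ennreal (alpha_sum 0 f u x powr 1) = ennreal (alpha_sum 0 f u x)"
    if "\<And>x. 0 \<le> u x" "\<And>x. u x \<le> 1" for u x
    using that by simp
  then show ?thesis
    using nn_integral_alpha_sum_0_powr_le_reflection[OF peak[OF f] peak[OF g], of 1] C_alpha_bounds[OF g] True
    by (simp add: L1_norm_def reflection_def)
next
  case False
  with assms(1) have neg: "\<alpha> < 0" by simp
  define F where "F x = log_scale \<alpha> (f x)" for x
  define G where "G x = log_scale \<alpha> (g x)" for x
  have peak: "log_concave_peak F" "log_concave_peak G"
    using log_scale_log_concave_peak[OF neg f] log_scale_log_concave_peak[OF neg g]
    by (simp_all add: F_def[abs_def] G_def[abs_def])
  have bounds: "0 \<le> F x" "F x \<le> 1" "fsigma {x. s < F x}" "0 \<le> G x" "G x \<le> 1" "fsigma {x. s < G x}" for x s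
    using peak by (auto simp: log_concave_peak_def)
  have "fsigma {x. s < reflection G x}" for s
  proof -
    have "{x. s < reflection G x} = uminus ` {x. s < G x}"
      by (auto simp: reflection_def image_iff) (metis minus_minus)
    then show ?thesis
      using bounds by (auto intro!: fsigma_continuous_image continuous_intros)
  qed
  then have meas: "alpha_sum 0 F G \<in> borel_measurable borel"
      "alpha_sum 0 F (reflection G) \<in> borel_measurable borel"
    using bounds by (auto intro!: borel_measurable_alpha_sum_0 simp: reflection_def)
  let ?w = "\<lambda>t. ennreal (indicator {0..} t * t powr (- (1 / \<alpha>) - 1) / exp t)"
  have mixture: "ennreal (Gamma (- (1 / \<alpha>))) * (\<integral>\<^sup>+x. ennreal (alpha_scale \<alpha> (W x)) \<partial>lborel)
      = (\<integral>\<^sup>+t. ?w t * (\<integral>\<^sup>+x. ennreal (W x powr t) \<partial>lborel) \<partial>lborel)"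
    if [measurable]: "W \<in> borel_measurable borel" and W: "\<And>x. 0 \<le> W x" "\<And>x. W x \<le> 1"
    for W :: "real ^ 'n \<Rightarrow> real"
  proof -
    have "(\<lambda>x. ennreal (alpha_scale \<alpha> (W x))) \<in> borel_measurable borel"
      unfolding alpha_scale_def by measurable
    then have "ennreal (Gamma (- (1 / \<alpha>))) * (\<integral>\<^sup>+x. ennreal (alpha_scale \<alpha> (W x)) \<partial>lborel)
        = (\<integral>\<^sup>+x. ennreal (Gamma (- (1 / \<alpha>))) * ennreal (alpha_scale \<alpha> (W x)) \<partial>lborel)"
      by (simp add: nn_integral_cmult)
    also have "\<dots> = (\<integral>\<^sup>+x. \<integral>\<^sup>+t. ?w t * ennreal (W x powr t) \<partial>lborel \<partial>lborel)"
      by (simp only: alpha_scale_eq_gamma_mixture[OF neg W])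
    also have "\<dots> = (\<integral>\<^sup>+t. \<integral>\<^sup>+x. ?w t * ennreal (W x powr t) \<partial>lborel \<partial>lborel)"
      by (rule lborel_pair.Fubini'[symmetric]) measurable
    also have "\<dots> = (\<integral>\<^sup>+t. ?w t * (\<integral>\<^sup>+x. ennreal (W x powr t) \<partial>lborel) \<partial>lborel)"
      by (intro nn_integral_cong nn_integral_cmult) measurable
    finally show ?thesis .
  qed
  have norm_sum: "L1_norm (alpha_sum \<alpha> f g) = (\<integral>\<^sup>+x. ennreal (alpha_scale \<alpha> (alpha_sum 0 F G x)) \<partial>lborel)"
    unfolding L1_norm_def F_def[abs_def] G_def[abs_def]
    by (simp only: alpha_sum_eq_alpha_scale[OF neg C_alpha_bounds[OF f] C_alpha_bounds[OF g]])
  have "0 \<le> reflection g x" "reflection g x \<le> 1" for x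
    using C_alpha_bounds[OF g] by (auto simp: reflection_def)
  then have norm_diff: "L1_norm (alpha_sum \<alpha> f (reflection g))
      = (\<integral>\<^sup>+x. ennreal (alpha_scale \<alpha> (alpha_sum 0 F (reflection G) x)) \<partial>lborel)"
    using alpha_sum_eq_alpha_scale[OF neg C_alpha_bounds[OF f], of "reflection g"]
    by (simp add: L1_norm_def F_def[abs_def] G_def[abs_def] reflection_def[abs_def])
  have sum_bounds: "0 \<le> alpha_sum 0 F G x" "alpha_sum 0 F G x \<le> 1"
      "0 \<le> alpha_sum 0 F (reflection G) x" "alpha_sum 0 F (reflection G) x \<le> 1" for x
    using bounds by (auto intro!: alpha_sum_bounds simp: reflection_def)
  let ?\<Gamma> = "ennreal (Gamma (- (1 / \<alpha>)))"
  have meas_slice: "(\<lambda>t. \<integral>\<^sup>+x. ennreal (alpha_sum 0 F (reflection G) x powr t) \<partial>lborel) \<in> borel_measurable borel"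
    using meas(2) by measurable
  have "?\<Gamma> * L1_norm (alpha_sum \<alpha> f g) = (\<integral>\<^sup>+t. ?w t * (\<integral>\<^sup>+x. ennreal (alpha_sum 0 F G x powr t) \<partial>lborel) \<partial>lborel)"
    unfolding norm_sum using sum_bounds by (intro mixture meas)
  also have "\<dots> \<le> (\<integral>\<^sup>+t. 2 ^ CARD('n) * (?w t * (\<integral>\<^sup>+x. ennreal (alpha_sum 0 F (reflection G) x powr t) \<partial>lborel)) \<partial>lborel)"
  proof (rule nn_integral_mono)
    fix t :: real
    show "?w t * (\<integral>\<^sup>+x. ennreal (alpha_sum 0 F G x powr t) \<partial>lborel)
      \<le> 2 ^ CARD('n) * (?w t * (\<integral>\<^sup>+x. ennreal (alpha_sum 0 F (reflection G) x powr t) \<partial>lborel))"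
    proof (cases "0 < t")
      case True
      then show ?thesis
        using mult_left_mono[OF nn_integral_alpha_sum_0_powr_le_reflection[OF peak True], of "?w t"]
        by (simp add: mult.left_commute)
    next
      case False
      \<comment> \<open>The density vanishes for negative \<open>t\<close>, and at \<open>0\<close> because \<open>0 powr s = 0\<close>.\<close>
      then have "?w t = 0" by (auto simp: indicator_def)
      then show ?thesis by (simp only: mult_zero_left mult_zero_right order.refl)
    qed
  qed
  also have "\<dots> = 2 ^ CARD('n) * (?\<Gamma> * L1_norm (alpha_sum \<alpha> f (reflection g)))"
    unfolding norm_diff using sum_bounds meas_slice
    by (subst mixture[OF meas(2)]) (auto intro!: nn_integral_cmult)
  also have "\<dots> = ?\<Gamma> * (2 ^ CARD('n) * L1_norm (alpha_sum \<alpha> f (reflection g)))"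
    by (simp add: mult.left_commute)
  finally have "?\<Gamma> * L1_norm (alpha_sum \<alpha> f g)
      \<le> ?\<Gamma> * (2 ^ CARD('n) * L1_norm (alpha_sum \<alpha> f (reflection g)))" .
  moreover have "?\<Gamma> \<noteq> 0" "?\<Gamma> \<noteq> top"
  proof -
    have "0 < - (1 / \<alpha>)"
      using neg by simp
    then have "0 < Gamma (- (1 / \<alpha>))"
      by (rule Gamma_real_pos)
    then show "?\<Gamma> \<noteq> 0" "?\<Gamma> \<noteq> top"
      by (simp_all add: ennreal_eq_0_iff)
  qed
  ultimately show ?thesis
    using ennreal_mult_le_mult_iff by blast
qed

lemma two_power_le_constant:
  fixes \<alpha> :: real
  assumes "- 1 / real n < \<alpha>" and "\<alpha> \<le> 0" and "0 < n"
  shows "2 ^ n \<le> min (real (n + 1) / 2 ^ n * real ((2 * n) choose n)) (2 ^ n / (\<Prod>j=1..n. 1 + real j * \<alpha>))"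
proof -
  have "(4::real) ^ n \<le> real ((n + 1) * ((2 * n) choose n))"
    using of_nat_mono[OF four_power_le_central_binomial[of n]] by (simp only: of_nat_power of_nat_numeral)
  moreover have "(4::real) ^ n = 2 ^ n * 2 ^ n"
    by (simp add: power_mult_distrib[symmetric])
  ultimately have "2 ^ n \<le> real (n + 1) / 2 ^ n * real ((2 * n) choose n)"
    by (simp add: field_simps)
  moreover have "2 ^ n \<le> 2 ^ n / (\<Prod>j=1..n. 1 + real j * \<alpha>)"
  proof -
    have factor: "0 < 1 + real j * \<alpha>" "1 + real j * \<alpha> \<le> 1" if "j \<in> {1..n}" for j
    proof -
      have "- 1 < real n * \<alpha>"
        using assms by (simp add: field_simps)
      also have "\<dots> \<le> real j * \<alpha>"
        using that assms by (intro mult_right_mono_neg) auto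
      finally show "0 < 1 + real j * \<alpha>" by simp
      show "1 + real j * \<alpha> \<le> 1"
        using assms by (simp add: mult_nonneg_nonpos)
    qed
    have "0 < (\<Prod>j=1..n. 1 + real j * \<alpha>)"
      by (intro prod_pos) (use factor in blast)
    moreover have "(\<Prod>j=1..n. 1 + real j * \<alpha>) \<le> 1"
      by (intro prod_le_1) (use factor less_imp_le in blast)
    ultimately show ?thesis
      by (simp add: field_simps)
  qed
  ultimately show ?thesis by simp
qed

theorem theorem5p2:
  fixes f g :: "real ^ 'n \<Rightarrow> real" and \<alpha> :: real
  assumes "- 1 / real CARD('n) < \<alpha>" and "\<alpha> \<le> 0"
    and "f \<in> C_alpha \<alpha>" and "g \<in> C_alpha \<alpha>"
  shows "L1_norm (alpha_sum \<alpha> f g)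
    \<le> ennreal (min (real (CARD('n) + 1) / 2 ^ CARD('n) * real ((2 * CARD('n)) choose CARD('n)))
                   (2 ^ CARD('n) / (\<Prod>j=1..CARD('n). 1 + real j * \<alpha>)))
      * L1_norm (alpha_sum \<alpha> f (reflection g))"
    (is "_ \<le> ennreal ?c * _")
proof -
  have "(2::ennreal) ^ CARD('n) = ennreal (2 ^ CARD('n))"
    by (simp add: ennreal_power flip: ennreal_numeral)
  also have "\<dots> \<le> ennreal ?c"
    using assms(1,2) by (intro ennreal_leI two_power_le_constant) auto
  finally have "2 ^ CARD('n) \<le> ennreal ?c" .
  then show ?thesis
    by (intro order.trans[OF L1_norm_alpha_sum_le_reflection[OF assms(2-4)]] mult_right_mono) auto
qed

end
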